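(* Let $d\ge 3$ and let $T_d$ be the $d$-regular directed tree. Put $$p_{c,2}(T_d):=\frac{1}{(d^2-d-1)+\sqrt{(d^2-d-1)^2-(d-1)^2}} .$$ If $p_1=1-p$ and $p_2=p$ with $p\in[0,1]$ (all other $p_i=0$), then $$\theta(T_d,{\bf p})>0\quad\text{if and only if}\quad p>p_{c,2}(T_d).$$ Moreover, $p_{c,2}(T_d)$ is a decreasing function of $d$, satisfies $0<p_{c,2}(T_d)<1$, and $p_{c,2}(T_d)\sim \frac{1}{2d^2}$ as $d\to\infty$. In particular, for general ${\bf p}$: if $p_0+p_1=1$ then $\theta(T_d,{\bf p})=0$, and if $p_2+\cdots+p_d=1$ then $\theta(T_d,{\bf p})>0$.
   Context: $T_d=(V,E,o)$ is the connected $d$-regular directed graph without cycles, with a fixed origin $o$: $E$ is symmetric ($(x,y)\in E$ iff $(y,x)\in E$), and the underlying undirected graph is the infinite $d$-regular tree. Let $L_x=\{y:(x,y)\in E\}$, so $|L_x|=d$. Let ${\bf p}=(p_0,\dots,p_d)$ with $p_i\ge0$ and $\sum_i p_i=1$. Configurations are $\omega\in\Omega=\prod_{x\in V}2^{L_x}$ with the $\sigma$-field generated by finite-dimensional cylinders; $P_{\bf p}$ is the product measure under which the states $\omega(x)\subset L_x$ are independent with $P_{\bf p}(\omega(x)=S)=p_{|S|}/\binom{d}{|S|}$ for $S\subset L_x$. Put $E_\omega=\{(x,y):x\in V,\ y\in\omega(x)\}$. Vertices $x,y$ are weakly connected if $x=y$ or there are $x=z_0,\dots,z_m=y$ such that for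 each $i$, $(z_i,z_{i+1})\in E_\omega$ or $(z_{i+1},z_i)\in E_\omega$. $|C|$ is the number of vertices weakly connected to $o$, and $\theta(T_d,{\bf p})=P_{\bf p}(|C|=\infty)$. *)

theory Defs
  imports "HOL-Probability.Probability"
begin

text \<open>
  The edge set is symmetric, so each undirected edge is represented by two opposite directed
  edges; ``without cycles'' therefore refers to the underlying undirected graph, i.e. to closed
  paths through at least three distinct vertices (loops are excluded by \<open>irrefl\<close>).
  These axioms determine the graph up to isomorphism, and statements are made for every such
  graph \<open>(V, E)\<close>. The neighbourhood of \<open>x\<close> is \<open>E `` {x}\<close>.
\<close>

locale regular_tree =
  fixes d :: nat and V :: "'v set" and E :: "('v \<times> 'v) set"
  assumes nonempty: "V \<noteq> {}"
    and edges: "E \<subseteq> V \<times> V"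
    and sym: "sym E"
    and irrefl: "irrefl E"
    and finite_nbrs: "x \<in> V \<Longrightarrow> finite (E `` {x})"
    and regular: "x \<in> V \<Longrightarrow> card (E `` {x}) = d"
    and connected: "x \<in> V \<Longrightarrow> y \<in> V \<Longrightarrow> (x, y) \<in> E\<^sup>*"
    and no_cycle: "distinct xs \<Longrightarrow> 3 \<le> length xs \<Longrightarrow>
       \<exists>i<length xs. (xs ! i, xs ! (Suc i mod length xs)) \<notin> E"

text \<open>Only the values at indices \<open>0, \<dots>, d\<close> are relevant.\<close>

definition prob_vector :: "nat \<Rightarrow> (nat \<Rightarrow> real) \<Rightarrow> bool" where
  "prob_vector d p \<longleftrightarrow> (\<forall>i\<le>d. 0 \<le> p i) \<and> (\<Sum>i\<le>d. p i) = 1"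

definition state_measure :: "nat \<Rightarrow> ('v \<times> 'v) set \<Rightarrow> (nat \<Rightarrow> real) \<Rightarrow> 'v \<Rightarrow> 'v set measure" where
  "state_measure d E p x =
     point_measure (Pow (E `` {x})) (\<lambda>S. ennreal (p (card S) / real (d choose card S)))"

definition config_measure ::
  "nat \<Rightarrow> 'v set \<Rightarrow> ('v \<times> 'v) set \<Rightarrow> (nat \<Rightarrow> real) \<Rightarrow> ('v \<Rightarrow> 'v set) measure" where
  "config_measure d V E p = PiM V (state_measure d E p)"

definition open_edges :: "'v set \<Rightarrow> ('v \<Rightarrow> 'v set) \<Rightarrow> ('v \<times> 'v) set" where
  "open_edges V \<omega> = {(x, y). x \<in> V \<and> y \<in> \<omega> x}"

definition weakly_connected :: "'v set \<Rightarrow> ('v \<Rightarrow> 'v set) \<Rightarrow> 'v \<Rightarrow> 'v \<Rightarrow> bool" where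
  "weakly_connected V \<omega> x y \<longleftrightarrow> (x, y) \<in> (open_edges V \<omega> \<union> (open_edges V \<omega>)\<inverse>)\<^sup>*"

definition cluster :: "'v set \<Rightarrow> ('v \<Rightarrow> 'v set) \<Rightarrow> 'v \<Rightarrow> 'v set" where
  "cluster V \<omega> x = {y \<in> V. weakly_connected V \<omega> x y}"

definition theta :: "nat \<Rightarrow> 'v set \<Rightarrow> ('v \<times> 'v) set \<Rightarrow> 'v \<Rightarrow> (nat \<Rightarrow> real) \<Rightarrow> real" where
  "theta d V E r p =
     measure (config_measure d V E p)
       {\<omega> \<in> space (config_measure d V E p). infinite (cluster V \<omega> r)}"

definition pc2 :: "nat \<Rightarrow> real" where
  "pc2 d = 1 / (((real d)\<^sup>2 - real d - 1)
              + sqrt (((real d)\<^sup>2 - real d - 1)\<^sup>2 - (real d - 1)\<^sup>2))"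


subsection \<open>Sanity checks\<close>

lemma (in regular_tree) prob_space_state_measure:
  assumes p: "prob_vector d p" and x: "x \<in> V"
  shows "prob_space (state_measure d E p x)"
proof
  let ?L = "E `` {x}"
  let ?f = "\<lambda>S. p (card S) / real (d choose card S)"
  have fin: "finite ?L" and card: "card ?L = d"
    using x finite_nbrs regular by auto
  have le: "card S \<le> d" if "S \<in> Pow ?L" for S
    using that card_mono[OF fin, of S] card by simp
  have nn: "0 \<le> ?f S" if "S \<in> Pow ?L" for S
    using le[OF that] p by (simp add: prob_vector_def)
  have "emeasure (state_measure d E p x) (space (state_measure d E p x))
      = (\<Sum>S\<in>Pow ?L. ennreal (?f S))"
    using fin by (simp add: state_measure_def space_point_measure emeasure_point_measure_finite)
  also have "\<dots> = ennreal (\<Sum>S\<in>Pow ?L. ?f S)"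
    using nn by (rule sum_ennreal)
  also have "(\<Sum>S\<in>Pow ?L. ?f S) = (\<Sum>i\<le>d. \<Sum>S\<in>{S \<in> Pow ?L. card S = i}. ?f S)"
    by (rule sum.group[symmetric]) (use fin le in auto)
  also have "\<dots> = (\<Sum>i\<le>d. p i)"
  proof (rule sum.cong[OF refl])
    fix i assume i: "i \<in> {..d}"
    have "(\<Sum>S\<in>{S \<in> Pow ?L. card S = i}. ?f S)
        = (\<Sum>S\<in>{S. S \<subseteq> ?L \<and> card S = i}. p i / real (d choose i))"
      by (rule sum.cong) auto
    also have "\<dots> = real (d choose i) * (p i / real (d choose i))"
      using n_subsets[OF fin, of i] card by simp
    also have "\<dots> = p i" using i by simp
    finally show "(\<Sum>S\<in>{S \<in> Pow ?L. card S = i}. ?f S) = p i" .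
  qed
  finally show "emeasure (state_measure d E p x) (space (state_measure d E p x)) = 1"
    using p by (simp add: prob_vector_def)
qed

text \<open>
  A concrete model: words over \<open>{..<d}\<close> without two equal consecutive letters, where prepending
  a letter is moving to a child (the Cayley graph of the free product of \<open>d\<close> groups of order 2).
\<close>

definition words :: "nat \<Rightarrow> nat list set" where
  "words d = {w. set w \<subseteq> {..<d} \<and> distinct_adj w}"

definition word_edges :: "nat \<Rightarrow> (nat list \<times> nat list) set" where
  "word_edges d = {(v, w) \<in> words d \<times> words d. (\<exists>a. w = a # v) \<or> (\<exists>a. v = a # w)}"

lemma word_edges_cycle:
  assumes "distinct xs" "3 \<le> length xs"
  shows "\<exists>i<length xs. (xs ! i, xs ! (Suc i mod length xs)) \<notin> word_edges d"
proof (rule ccontr)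
  let ?n = "length xs"
  assume "\<not> ?thesis"
  then have e: "(xs ! i, xs ! (Suc i mod ?n)) \<in> word_edges d" if "i < ?n" for i
    using that by blast
  define m where "m = Max ((\<lambda>i. length (xs ! i)) ` {..<?n})"
  have "m \<in> (\<lambda>i. length (xs ! i)) ` {..<?n}"
    unfolding m_def using assms(2) by (intro Max_in) (auto simp: lessThan_empty_iff)
  then obtain j where j: "j < ?n" "length (xs ! j) = m" by auto
  have max: "length (xs ! i) \<le> length (xs ! j)" if "i < ?n" for i
    unfolding j(2) m_def using that by (intro Max_ge) auto
  define s where "s = Suc j mod ?n"
  define q where "q = (if j = 0 then ?n - 1 else j - 1)"
  have s: "s < ?n" and q: "q < ?n" and qj: "Suc q mod ?n = j" and sq: "s \<noteq> q"
    using assms(2) j(1) by (auto simp: s_def q_def mod_Suc)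
  have "xs ! s = tl (xs ! j)"
    using e[OF j(1)] max[OF s] by (auto simp: word_edges_def s_def[symmetric])
  moreover have "xs ! q = tl (xs ! j)"
    using e[OF q] max[OF q] by (auto simp: word_edges_def qj)
  ultimately show False
    using sq s q assms(1) nth_eq_iff_index_eq[of xs s q] by metis
qed

lemma regular_tree_words:
  assumes "1 \<le> d"
  shows "regular_tree d (words d) (word_edges d)"
proof
  show "words d \<noteq> {}" by (auto simp: words_def intro: exI[of _ "[]"])
  show "word_edges d \<subseteq> words d \<times> words d" by (auto simp: word_edges_def)
  show sym: "sym (word_edges d)" by (auto simp: sym_def word_edges_def)
  show "irrefl (word_edges d)" by (auto simp: irrefl_def word_edges_def)
  have nbrs: "finite (word_edges d `` {x}) \<and> card (word_edges d `` {x}) = d"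
    if x: "x \<in> words d" for x
  proof (cases x)
    case Nil
    have "word_edges d `` {x} = (\<lambda>a. [a]) ` {..<d}"
      by (auto simp: word_edges_def words_def Nil)
    then show ?thesis by (simp add: card_image inj_on_def)
  next
    case (Cons b w)
    have eq: "word_edges d `` {x} = insert w ((\<lambda>a. a # x) ` ({..<d} - {b}))"
      using x by (auto simp: word_edges_def words_def Cons distinct_adj_Cons)
    have "b < d" using x by (simp add: words_def Cons)
    moreover have "w \<notin> (\<lambda>a. a # x) ` ({..<d} - {b})" by (auto simp: Cons)
    ultimately show ?thesis
      unfolding eq using assms by (simp add: card_image inj_on_def)
  qed
  show "finite (word_edges d `` {x})" if "x \<in> words d" for x using nbrs[OF that] by simp
  show "card (word_edges d `` {x}) = d" if "x \<in> words d" for x using nbrs[OF that] by simp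
  have root: "(x, []) \<in> (word_edges d)\<^sup>*" if "x \<in> words d" for x
    using that
  proof (induction x)
    case (Cons a x)
    then have "x \<in> words d" by (auto simp: words_def distinct_adj_Cons)
    moreover from this have "(a # x, x) \<in> word_edges d"
      using Cons.prems by (auto simp: word_edges_def)
    ultimately show ?case using Cons.IH by (meson converse_rtrancl_into_rtrancl)
  qed simp
  show "(x, y) \<in> (word_edges d)\<^sup>*" if "x \<in> words d" "y \<in> words d" for x y
    using root[OF that(1)] root[OF that(2)] sym by (meson rtrancl_trans symD sym_rtrancl)
  show "\<exists>i<length xs. (xs ! i, xs ! (Suc i mod length xs)) \<notin> word_edges d"
    if "distinct xs" "3 \<le> length xs" for xs
    using that by (rule word_edges_cycle)
qed

end

theory Submission
  imports Defs "HOL-Real_Asymp.Real_Asymp"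
begin

text \<open>
  Exploring the cluster away from the root yields a branching process with two types: a vertex
  selected by its parent, and a vertex that has to select its parent in order to be linked to it.
  Since distinct branches of the tree depend on disjoint sets of coordinates, the survival
  probabilities \<open>(a, b)\<close> of the two types up to level \<open>n\<close> satisfy an explicit recursion with a
  monotone map \<open>F\<close>, and \<open>\<theta> > 0\<close> iff their limit, a fixed point of \<open>F\<close>, is nonzero.
  By Bernoulli's inequality \<open>F\<close> lies below its linearisation \<open>A\<close> at \<open>0\<close>, strictly in a term of
  positive weight. For sizes 1 and 2, with \<open>D = d - 1\<close>, one has
  \<open>d\<^sup>2 det (I - A) = (1 - pD) (1 - p(D - 2)) - 2pD(D - p) = 1 - 2p(d\<^sup>2 - d - 1) + p\<^sup>2D\<^sup>2\<close>,
  whose smaller root is the critical value. Where this is nonnegative (below the larger root),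
  \<open>0\<close> is the only fixed point in the unit square, also at criticality because of strictness; where
  it is negative, \<open>A v > v\<close> for some positive \<open>v\<close>, and a small multiple of \<open>v\<close> is a subsolution of
  \<open>F\<close> that bounds all survival probabilities from below.
\<close>

subsection \<open>Non-backtracking walks\<close>

text \<open>Only immediate reversals are forbidden. This is a local condition, convenient for
  induction, and in a tree it already forces all vertices of the walk to be distinct
  (\<open>nbw_distinct\<close>).\<close>

fun nbw :: "('a \<times> 'a) set \<Rightarrow> 'a list \<Rightarrow> bool" where
  "nbw R (x # y # z # xs) \<longleftrightarrow> (x, y) \<in> R \<and> x \<noteq> z \<and> nbw R (y # z # xs)"
| "nbw R [x, y] \<longleftrightarrow> (x, y) \<in> R"
| "nbw R [x] \<longleftrightarrow> True"
| "nbw R [] \<longleftrightarrow> True"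

lemma nbw_tl: "nbw R (x # xs) \<Longrightarrow> nbw R xs"
  by (cases "(R, x # xs)" rule: nbw.cases) auto

lemma nbw_mono: "nbw R xs \<Longrightarrow> R \<subseteq> S \<Longrightarrow> nbw S xs"
  by (induction R xs rule: nbw.induct) auto

lemma nbw_nth: "nbw R xs \<Longrightarrow> Suc i < length xs \<Longrightarrow> (xs ! i, xs ! Suc i) \<in> R"
proof (induction R xs arbitrary: i rule: nbw.induct)
  case (1 R x y z xs)
  then show ?case by (cases i) auto
qed auto

text \<open>The defining condition involves at most three consecutive vertices, so gluing at
  \<open>x\<close> creates a single new triple, \<open>y, x, z\<close>.\<close>

lemma nbw_append:
  "nbw R (xs @ [y, x]) \<Longrightarrow> nbw R (x # z # ys) \<Longrightarrow> y \<noteq> z \<Longrightarrow> nbw R (xs @ [y, x, z] @ ys)"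
proof (induction xs)
  case (Cons a xs)
  then show ?case
    by (cases xs; cases "tl xs") auto
qed simp

lemma nbw_rev: "sym R \<Longrightarrow> nbw R xs \<Longrightarrow> nbw R (rev xs)"
proof (induction R xs rule: nbw.induct)
  case (1 R x y z xs)
  then show ?case
    using nbw_append[of R "rev xs" z y x "[]"] by (auto dest: symD)
qed (auto dest: symD)

lemma nbw_relpow: "nbw R (x # xs) \<Longrightarrow> (x, last (x # xs)) \<in> R ^^ length xs"
proof (induction xs arbitrary: x)
  case (Cons y xs)
  from Cons.prems have "(x, y) \<in> R"
    by (cases xs) auto
  moreover have "(y, last (y # xs)) \<in> R ^^ length xs"
    using Cons.IH[of y] Cons.prems by (simp add: nbw_tl)
  ultimately show ?case
    using relpow_Suc_I2[of x y R] by simp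
qed simp

lemma nbw_reachable: "nbw R (x # xs) \<Longrightarrow> z \<in> set (x # xs) \<Longrightarrow> (x, z) \<in> R\<^sup>*"
proof (induction xs arbitrary: x)
  case (Cons y xs)
  from Cons.prems have "(x, y) \<in> R"
    by (cases xs) auto
  moreover have "(y, z) \<in> R\<^sup>*" if "z \<in> set (y # xs)"
    using Cons.IH[OF nbw_tl[OF Cons.prems(1)] that] .
  ultimately show ?case
    using Cons.prems(2) by (auto intro: converse_rtrancl_into_rtrancl)
qed simp

text \<open>If a walk reaches the vertex before last, drop the last step instead of turning back.\<close>

lemma rtrancl_imp_nbw:
  assumes "sym R" "(x, z) \<in> R\<^sup>*"
  shows "\<exists>xs. nbw R (x # xs) \<and> last (x # xs) = z"
  using assms(2)
proof (induction rule: converse_rtrancl_induct)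
  case base
  then show ?case by (intro exI[of _ "[]"]) simp
next
  case (step w x)
  then obtain xs where xs: "nbw R (x # xs)" "last (x # xs) = z"
    by auto
  show ?case
  proof (cases "xs \<noteq> [] \<and> hd xs = w")
    case True
    then obtain ys where "xs = w # ys" by (cases xs) auto
    then show ?thesis
      using xs nbw_tl by (intro exI[of _ ys]) auto
  next
    case False
    then have "nbw R (w # x # xs)"
      using xs step.hyps by (cases xs) auto
    then show ?thesis
      using xs by (intro exI[of _ "x # xs"]) auto
  qed
qed

section \<open>Walks of given depth and the branches they explore\<close>

primrec reach :: "('a \<times> 'a) set \<Rightarrow> nat \<Rightarrow> 'a \<Rightarrow> 'a \<Rightarrow> bool" where
  "reach R 0 u x \<longleftrightarrow> True"
| "reach R (Suc n) u x \<longleftrightarrow> (\<exists>y. (x, y) \<in> R \<and> y \<noteq> u \<and> reach R n x y)"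

text \<open>The depth counts the steps made after the one from \<open>u\<close> to \<open>x\<close>.
  That first step is not tested by \<open>reach\<close>, hence the hypothesis.\<close>

lemma reach_iff_nbw:
  "(u, x) \<in> R \<Longrightarrow> reach R n u x \<longleftrightarrow> (\<exists>xs. length xs = n \<and> nbw R (u # x # xs))"
proof (induction n arbitrary: u x)
  case (Suc n)
  have "reach R (Suc n) u x \<longleftrightarrow>
      (\<exists>y. (x, y) \<in> R \<and> y \<noteq> u \<and> (\<exists>xs. length xs = n \<and> nbw R (x # y # xs)))"
    using Suc.IH by auto
  also have "\<dots> \<longleftrightarrow> (\<exists>xs. length xs = Suc n \<and> nbw R (u # x # xs))"
  proof safe
    fix y xs assume *: "(x, y) \<in> R" "y \<noteq> u" "nbw R (x # y # xs)" "n = length xs"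
    show "\<exists>ys. length ys = Suc (length xs) \<and> nbw R (u # x # ys)"
      by (rule exI[of _ "y # xs"]) (use * Suc.prems in auto)
  next
    fix xs assume *: "length xs = Suc n" "nbw R (u # x # xs)"
    then obtain y ys where xs: "xs = y # ys" by (cases xs) auto
    show "\<exists>y. (x, y) \<in> R \<and> y \<noteq> u \<and> (\<exists>xs. length xs = n \<and> nbw R (x # y # xs))"
      by (rule exI[of _ y], intro conjI exI[of _ ys])
        (use * nbw_nth[of R "u # x # xs" 1] in \<open>auto simp: xs\<close>)
  qed
  finally show ?case .
qed auto

lemma reach_Suc_imp_reach: "reach R (Suc n) u x \<Longrightarrow> reach R n u x"
proof (induction n arbitrary: u x)
  case (Suc n)
  then show ?case unfolding reach.simps(2)[of R "Suc n"] reach.simps(2)[of R n] by blast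
qed simp

lemma reach_antimono: "m \<le> n \<Longrightarrow> reach R n u x \<Longrightarrow> reach R m u x"
  by (induction n rule: dec_induct) (auto dest: reach_Suc_imp_reach simp del: reach.simps(2))

text \<open>For the tree edges, this is the set of coordinates that can influence survival to depth
  \<open>n\<close> beyond \<open>x\<close> (\<open>reach_link_cong\<close>); independence will come
  from the disjointness of such sets.\<close>

primrec branch :: "('a \<times> 'a) set \<Rightarrow> nat \<Rightarrow> 'a \<Rightarrow> 'a \<Rightarrow> 'a set" where
  "branch R 0 u x = {x}"
| "branch R (Suc n) u x = insert x (\<Union>y\<in>R `` {x} - {u}. branch R n x y)"

lemma branch_imp_nbw:
  "z \<in> branch R n u x \<Longrightarrow> (u, x) \<in> R \<Longrightarrow> \<exists>xs. nbw R (u # x # xs) \<and> last (x # xs) = z"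
proof (induction n arbitrary: u x)
  case 0
  then show ?case by (intro exI[of _ "[]"]) auto
next
  case (Suc n)
  show ?case
  proof (cases "z = x")
    case True
    then show ?thesis using Suc.prems by (intro exI[of _ "[]"]) auto
  next
    case False
    then obtain y where y: "(x, y) \<in> R" "y \<noteq> u" "z \<in> branch R n x y"
      using Suc.prems by auto
    then obtain xs where "nbw R (x # y # xs)" "last (y # xs) = z"
      using Suc.IH by blast
    then show ?thesis
      using Suc.prems y by (intro exI[of _ "y # xs"]) auto
  qed
qed

lemma self_in_branch: "x \<in> branch R n u x"
  by (cases n) auto

text \<open>Weak connection ignores orientation, so the relation is symmetric for symmetric
  \<open>E\<close>. Restricting it to \<open>E\<close> keeps it inside the tree for every function
  \<open>\<omega>\<close>, also for one outside the configuration space.\<close>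

definition link :: "('a \<times> 'a) set \<Rightarrow> ('a \<Rightarrow> 'a set) \<Rightarrow> ('a \<times> 'a) set" where
  "link E \<omega> = {(x, y) \<in> E. y \<in> \<omega> x \<or> x \<in> \<omega> y}"

lemma link_subset: "link E \<omega> \<subseteq> E"
  by (auto simp: link_def)

lemma sym_link: "sym E \<Longrightarrow> sym (link E \<omega>)"
  by (auto simp: link_def sym_def)

lemma reach_link_Suc:
  "reach (link E \<omega>) (Suc n) u x \<longleftrightarrow>
     (\<exists>y\<in>E `` {x} - {u}. (y \<in> \<omega> x \<or> x \<in> \<omega> y) \<and> reach (link E \<omega>) n x y)"
  by (auto simp: link_def)

lemma reach_link_cong:
  "(\<And>z. z \<in> branch E n u x \<Longrightarrow> \<omega> z = \<omega>' z) \<Longrightarrow>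
     reach (link E \<omega>) n u x \<longleftrightarrow> reach (link E \<omega>') n u x"
proof (induction n arbitrary: u x)
  case (Suc n)
  have "((y \<in> \<omega> x \<or> x \<in> \<omega> y) \<and> reach (link E \<omega>) n x y) =
        ((y \<in> \<omega>' x \<or> x \<in> \<omega>' y) \<and> reach (link E \<omega>') n x y)" if y: "y \<in> E `` {x} - {u}" for y
  proof -
    have "\<omega> x = \<omega>' x" "\<omega> y = \<omega>' y"
      using Suc.prems y self_in_branch[of y E n x] by auto
    moreover have "reach (link E \<omega>) n x y = reach (link E \<omega>') n x y"
      using y by (intro Suc.IH Suc.prems) auto
    ultimately show ?thesis by simp
  qed
  then show ?case unfolding reach_link_Suc by blast
qed simp

section \<open>Geometry of the tree and a criterion for infinite clusters\<close>

context regular_tree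
begin

text \<open>The first return to \<open>x\<close> would close a cycle. A cycle with one vertex
  contradicts irreflexivity, one with two vertices is an immediate reversal, and longer ones are
  excluded by \<open>no_cycle\<close>.\<close>

lemma nbw_distinct: "nbw E xs \<Longrightarrow> distinct xs"
proof (induction xs)
  case (Cons x xs)
  have dist: "distinct xs" using Cons.IH[OF nbw_tl[OF Cons.prems]] .
  moreover have "x \<notin> set xs"
  proof
    assume "x \<in> set xs"
    then obtain as bs where xs: "xs = as @ x # bs" and as: "x \<notin> set as"
      by (meson split_list_first)
    let ?c = "x # as"
    have e: "((?c @ x # bs) ! i, (?c @ x # bs) ! Suc i) \<in> E" if "i < length ?c" for i
      using nbw_nth[OF Cons.prems, of i] that xs by auto
    have "as \<noteq> []"
      using e[of 0] irrefl by (auto simp: irrefl_def)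
    moreover have "length as \<noteq> 1"
      using Cons.prems xs by (auto simp: length_Suc_conv)
    ultimately have "3 \<le> length ?c"
      by (cases as; cases "tl as") auto
    moreover have "distinct ?c" using dist xs as by auto
    ultimately obtain i where i: "i < length ?c" "(?c ! i, ?c ! (Suc i mod length ?c)) \<notin> E"
      using no_cycle by blast
    moreover have "(?c @ x # bs) ! i = ?c ! i"
      using i by (simp only: nth_append if_True)
    moreover have "(?c @ x # bs) ! Suc i = ?c ! (Suc i mod length ?c)"
    \<comment> \<open>The closing edge of the cycle is the one at which the index wraps around to
      0.\<close>
    proof (cases "Suc i = length ?c")
      case True
      then have "Suc i mod length ?c = 0" by (simp only: mod_self)
      then show ?thesis using True by (simp add: nth_append)
    next
      case False
      then have "Suc i < length ?c" using i by simp
      then show ?thesis by (simp only: nth_append if_True mod_less)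
    qed
    ultimately show False using e[OF i(1)] by simp
  qed
  ultimately show ?case by simp
qed simp

lemma branch_subset: "(u, x) \<in> E \<Longrightarrow> branch E n u x \<subseteq> V"
  by (induction n arbitrary: u x) (use edges in auto)

lemma not_in_branch: "(x, y) \<in> E \<Longrightarrow> x \<notin> branch E n x y"
proof
  assume "(x, y) \<in> E" "x \<in> branch E n x y"
  then obtain xs where "nbw E (x # y # xs)" "last (y # xs) = x"
    using branch_imp_nbw by metis
  then show False
    using nbw_distinct[of "x # y # xs"] last_in_set[of "y # xs"] by (simp del: last.simps)
qed

text \<open>A common vertex would be the end of two walks leaving \<open>x\<close> through different
  neighbours. Reversing one and gluing at \<open>x\<close> gives a non-backtracking walk that visits
  this vertex twice.\<close>

lemma branch_disjoint:
  assumes "(x, y) \<in> E" "(x, z) \<in> E" "y \<noteq> z"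
  shows "branch E n x y \<inter> branch E n x z = {}"
proof (rule ccontr)
  assume "\<not> ?thesis"
  then obtain v where "v \<in> branch E n x y" "v \<in> branch E n x z" by auto
  then obtain xs ys where xs: "nbw E (x # y # xs)" "last (y # xs) = v"
    and ys: "nbw E (x # z # ys)" "last (z # ys) = v"
    using branch_imp_nbw assms by metis
  have "nbw E (rev xs @ [y, x])"
    using nbw_rev[OF sym xs(1)] by simp
  then have "distinct (rev xs @ [y, x, z] @ ys)"
    using nbw_append ys(1) assms(3) nbw_distinct by metis
  then show False
    using last_in_set[of "y # xs"] last_in_set[of "z # ys"] xs(2) ys(2) assms(3)
    by auto
qed

lemma finite_ball: "x \<in> V \<Longrightarrow> finite ((E ^^ k) `` {x})"
proof (induction k)
  case (Suc k)
  have "(E ^^ Suc k) `` {x} = (\<Union>y\<in>(E ^^ k) `` {x}. E `` {y})"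
    by auto
  moreover have "(E ^^ k) `` {x} \<subseteq> V"
    using Suc.prems edges by (cases k) auto
  ultimately show ?case
    using Suc by (auto intro!: finite_nbrs)
qed simp

lemma cluster_eq:
  assumes \<omega>: "\<And>x. x \<in> V \<Longrightarrow> \<omega> x \<subseteq> E `` {x}" and r: "r \<in> V"
  shows "cluster V \<omega> r = {y. (r, y) \<in> (link E \<omega>)\<^sup>*}"
proof -
  have "open_edges V \<omega> \<union> (open_edges V \<omega>)\<inverse> = link E \<omega>"
  proof (intro equalityI subrelI)
    fix x y assume "(x, y) \<in> open_edges V \<omega> \<union> (open_edges V \<omega>)\<inverse>"
    then consider "x \<in> V" "y \<in> \<omega> x" | "y \<in> V" "x \<in> \<omega> y"
      by (auto simp: open_edges_def)
    then show "(x, y) \<in> link E \<omega>"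
      using \<omega> symD[OF sym] unfolding link_def by cases blast+
  next
    fix x y assume "(x, y) \<in> link E \<omega>"
    then show "(x, y) \<in> open_edges V \<omega> \<union> (open_edges V \<omega>)\<inverse>"
      using edges by (auto simp: open_edges_def link_def)
  qed
  moreover have "y \<in> V" if "(r, y) \<in> (link E \<omega>)\<^sup>*" for y
    using that r edges by (induction) (auto simp: link_def)
  ultimately show ?thesis
    by (auto simp: cluster_def weakly_connected_def)
qed

text \<open>If some depth is not reached, the cluster lies in a ball, which is finite since all
  degrees are. Conversely, a non-backtracking walk in the cluster has distinct vertices, so long
  walks exceed any finite size.\<close>

lemma infinite_cluster_iff:
  assumes \<omega>: "\<And>x. x \<in> V \<Longrightarrow> \<omega> x \<subseteq> E `` {x}" and r: "r \<in> V"
  shows "infinite (cluster V \<omega> r) \<longleftrightarrow> (\<forall>n. \<exists>y. (r, y) \<in> link E \<omega> \<and> reach (link E \<omega>) n r y)"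
    (is "_ \<longleftrightarrow> (\<forall>n. ?R n)")
proof
  let ?L = "link E \<omega>"
  assume inf: "infinite (cluster V \<omega> r)"
  show "\<forall>n. ?R n"
  proof (rule ccontr)
    assume "\<not> (\<forall>n. ?R n)"
    then obtain n where n: "\<not> ?R n" by blast
    have "cluster V \<omega> r \<subseteq> (\<Union>k\<le>n. (E ^^ k) `` {r})"
    proof
      fix z assume "z \<in> cluster V \<omega> r"
      then obtain xs where xs: "nbw ?L (r # xs)" "last (r # xs) = z"
        using cluster_eq[OF \<omega> r] rtrancl_imp_nbw[OF sym_link[OF sym]] by blast
      \<comment> \<open>Depth \<open>n\<close> counted from a neighbour of \<open>r\<close> amounts
        to \<open>n + 1\<close> edges from \<open>r\<close>, so its failure bounds every walk by
        \<open>n\<close> edges.\<close>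
      have "length xs \<le> n"
      proof (rule ccontr)
        assume "\<not> length xs \<le> n"
        then obtain y ys where ys: "xs = y # ys" "n \<le> length ys" by (cases xs) auto
        then have y: "(r, y) \<in> ?L" using nbw_nth[OF xs(1), of 0] by simp
        have "nbw ?L (r # y # ys)"
          using xs(1) ys(1) by (simp only:)
        then have "\<exists>zs. length zs = length ys \<and> nbw ?L (r # y # zs)"
          by blast
        then have "reach ?L (length ys) r y"
          by (simp only: reach_iff_nbw[OF y])
        then have "reach ?L n r y"
          by (rule reach_antimono[OF ys(2)])
        then show False
          using y n by blast
      qed
      then show "z \<in> (\<Union>k\<le>n. (E ^^ k) `` {r})"
        using nbw_relpow[OF nbw_mono[OF xs(1) link_subset]] xs(2) by auto
    qed
    then show False
      using inf finite_ball[OF r] finite_subset by blast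
  qed
next
  let ?L = "link E \<omega>"
  assume R: "\<forall>n. ?R n"
  show "infinite (cluster V \<omega> r)"
  proof
    assume fin: "finite (cluster V \<omega> r)"
    let ?n = "card (cluster V \<omega> r)"
    obtain y where y: "(r, y) \<in> ?L" "reach ?L ?n r y" using R by blast
    then obtain xs where xs: "length xs = ?n" "nbw ?L (r # y # xs)"
      unfolding reach_iff_nbw[OF y(1)] by blast
    \<comment> \<open>This walk has \<open>?n + 2\<close> distinct vertices, too many for a set of
      cardinality \<open>?n\<close>.\<close>
    have "set (r # y # xs) \<subseteq> cluster V \<omega> r"
      using nbw_reachable[OF xs(2)] cluster_eq[OF \<omega> r] by blast
    then have "card (set (r # y # xs)) \<le> ?n"
      using fin by (rule card_mono[rotated])
    moreover have "card (set (r # y # xs)) = length (r # y # xs)"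
      using nbw_distinct[OF nbw_mono[OF xs(2) link_subset]] distinct_card by blast
    ultimately show False using xs(1) by simp
  qed
qed

end

subsection \<open>Survival probabilities\<close>

lemma sum_Pow_card:
  fixes g :: "nat \<Rightarrow> real"
  assumes "finite N"
  shows "(\<Sum>T\<in>Pow N. g (card T)) = (\<Sum>k\<le>card N. real (card N choose k) * g k)"
proof -
  have "(\<Sum>T\<in>Pow N. g (card T)) = (\<Sum>k\<le>card N. \<Sum>T\<in>{T \<in> Pow N. card T = k}. g (card T))"
    by (rule sum.group[symmetric]) (use assms card_mono in auto)
  also have "\<dots> = (\<Sum>k\<le>card N. real (card N choose k) * g k)"
  proof (rule sum.cong[OF refl])
    fix k
    have "(\<Sum>T\<in>{T \<in> Pow N. card T = k}. g (card T)) = (\<Sum>T\<in>{T. T \<subseteq> N \<and> card T = k}. g k)"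
      by (rule sum.cong) auto
    then show "(\<Sum>T\<in>{T \<in> Pow N. card T = k}. g (card T)) = real (card N choose k) * g k"
      using n_subsets[OF assms, of k] by simp
  qed
  finally show ?thesis .
qed

text \<open>Used to split the states of a vertex according to whether they contain the
  parent.\<close>

lemma sum_Pow_remove:
  fixes f :: "'a set \<Rightarrow> real"
  assumes "finite L" "u \<in> L"
  shows "(\<Sum>S\<in>Pow L. f S) = (\<Sum>T\<in>Pow (L - {u}). f T + f (insert u T))"
proof -
  have "Pow L = Pow (L - {u}) \<union> insert u ` Pow (L - {u})"
    using Pow_insert[of u "L - {u}"] assms by (simp add: insert_absorb)
  moreover have "inj_on (insert u) (Pow (L - {u}))"
    by (auto simp: inj_on_def)
  moreover have "(\<Sum>S\<in>Pow (L - {u}) \<union> insert u ` Pow (L - {u}). f S) =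
      (\<Sum>S\<in>Pow (L - {u}). f S) + (\<Sum>S\<in>insert u ` Pow (L - {u}). f S)"
    by (rule sum.union_disjoint) (use assms in auto)
  ultimately show ?thesis
    by (simp add: sum.reindex sum.distrib)
qed

section \<open>The product measure and independence of branches\<close>

locale percolation = regular_tree d V E
  for d :: nat and V :: "'v set" and E :: "('v \<times> 'v) set" +
  fixes p :: "nat \<Rightarrow> real"
  assumes p: "prob_vector d p"
begin

abbreviation M where "M \<equiv> state_measure d E p"
abbreviation P where "P \<equiv> config_measure d V E p"

definition w :: "nat \<Rightarrow> real" where
  "w k = p k / real (d choose k)"

lemma space_state [simp]: "space (M x) = Pow (E `` {x})"
  and sets_state [simp]: "sets (M x) = Pow (Pow (E `` {x}))"
  by (auto simp: state_measure_def space_point_measure sets_point_measure)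

lemma prob_state_measure: "x \<in> V \<Longrightarrow> prob_space (M x)"
  using p by (rule prob_space_state_measure)

sublocale prob_space P
  unfolding config_measure_def by (intro prob_space_PiM prob_state_measure)

lemma w_nonneg: "k \<le> d \<Longrightarrow> 0 \<le> w k"
  using p by (simp add: w_def prob_vector_def)

lemma nbr_in_V: "(x, y) \<in> E \<Longrightarrow> x \<in> V" "(x, y) \<in> E \<Longrightarrow> y \<in> V"
  using edges by auto

lemma config_subset: "\<omega> \<in> space P \<Longrightarrow> x \<in> V \<Longrightarrow> \<omega> x \<subseteq> E `` {x}"
  by (auto simp: config_measure_def space_PiM PiE_iff)

lemma pred_state: "x \<in> J \<Longrightarrow> Measurable.pred (PiM J M) (\<lambda>\<omega>. Q (\<omega> x))"
  by (rule measurable_compose[OF measurable_component_singleton[of x J M]])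
    (auto simp: pred_def)

text \<open>The index set \<open>J\<close> is left free: with a branch for \<open>J\<close> the
  event is local to that branch, with \<open>V\<close> it is an event of the whole space.\<close>

lemma pred_reach:
  "(u, x) \<in> E \<Longrightarrow> branch E n u x \<subseteq> J \<Longrightarrow>
     Measurable.pred (PiM J M) (\<lambda>\<omega>. reach (link E \<omega>) n u x)"
proof (induction n arbitrary: u x)
  case (Suc n)
  have "Measurable.pred (PiM J M) (\<lambda>\<omega>. (y \<in> \<omega> x \<or> x \<in> \<omega> y) \<and> reach (link E \<omega>) n x y)"
    if y: "y \<in> E `` {x} - {u}" for y
  proof -
    have "x \<in> J" "y \<in> J"
      using Suc.prems y self_in_branch[of y E n x] by auto
    then show ?thesis
      using Suc.prems y
      by (intro pred_intros_logic pred_state Suc.IH) auto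
  qed
  then show ?case
    unfolding reach_link_Suc
    using finite_nbrs[OF nbr_in_V(2)[OF Suc.prems(1)]] by (intro pred_intros_finite) auto
qed simp

lemma prob_state:
  assumes "x \<in> V" "S \<subseteq> E `` {x}"
  shows "prob {\<omega> \<in> space P. \<omega> x = S} = w (card S)"
proof -
  have "prob {\<omega> \<in> space P. \<omega> x = S} = measure (distr P (M x) (\<lambda>\<omega>. \<omega> x)) {S}"
    using assms by (subst measure_distr)
      (auto simp: config_measure_def intro!: arg_cong2[where f = measure])
  also have "distr P (M x) (\<lambda>\<omega>. \<omega> x) = M x"
    unfolding config_measure_def
    by (intro distr_PiM_component prob_state_measure assms)
  also have "measure (M x) {S} = w (card S)"
  proof -
    have "card S \<le> d"
      using assms regular[of x] finite_nbrs[of x] card_mono by metis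
    then have "0 \<le> w (card S)" by (rule w_nonneg)
    then show ?thesis
      using assms finite_nbrs[of x]
      by (simp add: state_measure_def measure_def emeasure_point_measure_finite w_def)
  qed
  finally show ?thesis .
qed

text \<open>Restriction to \<open>V\<close> is the identity on the configuration space, so the joint
  law of the coordinates is already the product of their marginals.\<close>

lemma indep_states: "indep_vars M (\<lambda>x \<omega>. \<omega> x) V"
proof -
  have "distr P P (\<lambda>\<omega>. restrict \<omega> V) = distr P P (\<lambda>\<omega>. \<omega>)"
    by (rule distr_cong) (auto simp: config_measure_def space_PiM PiE_restrict)
  also have "\<dots> = PiM V (\<lambda>x. distr P (M x) (\<lambda>\<omega>. \<omega> x))"
    by (simp add: config_measure_def distr_PiM_component prob_state_measure cong: PiM_cong)
  finally show ?thesis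
    using nonempty
    by (subst indep_vars_iff_distr_eq_PiM')
      (auto simp: config_measure_def intro!: measurable_component_singleton)
qed

text \<open>The state of \<open>x\<close> and the branches at its neighbours live on pairwise
  disjoint blocks of coordinates; \<open>meas\<close> and \<open>local\<close> turn each
  \<open>Q y\<close> into an event of its own block.\<close>

lemma prob_state_branches:
  assumes x: "x \<in> V" and N: "N \<subseteq> E `` {x}"
    and meas: "\<And>y. y \<in> N \<Longrightarrow> Measurable.pred (PiM (branch E n x y) M) (Q y)"
    and local: "\<And>y \<omega>. y \<in> N \<Longrightarrow> Q y (restrict \<omega> (branch E n x y)) = Q y \<omega>"
  shows "prob {\<omega> \<in> space P. \<omega> x = S \<and> (\<forall>y\<in>N. Q y \<omega>)} =
    prob {\<omega> \<in> space P. \<omega> x = S} * (\<Prod>y\<in>N. prob {\<omega> \<in> space P. Q y \<omega>})"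
proof -
  \<comment> \<open>Since \<open>x\<close> is not in \<open>N\<close>, it can index its own
    singleton block, so that the state and the branches form one family.\<close>
  let ?K = "\<lambda>y. if y = x then {x} else branch E n x y"
  let ?Q = "\<lambda>y \<omega>. if y = x then \<omega> x = S else Q y \<omega>"
  let ?A = "\<lambda>y. {\<eta> \<in> space (PiM (?K y) M). ?Q y \<eta>}"
  let ?X = "\<lambda>y \<omega>. restrict (\<lambda>z. \<omega> z) (?K y)"
  have xN: "x \<notin> N" using N irrefl by (auto simp: irrefl_def)
  have K: "?K y \<subseteq> V" if "y \<in> insert x N" for y
    using that x N branch_subset[of x y n] by auto
  have disj: "disjoint_family_on ?K (insert x N)"
    unfolding disjoint_family_on_def
  proof (intro ballI impI)
    fix y z assume yz: "y \<in> insert x N" "z \<in> insert x N" "y \<noteq> z"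
    have E: "(x, y) \<in> E" if "y \<in> insert x N" "y \<noteq> x" for y
      using that N by auto
    consider "y = x" "z \<noteq> x" | "y \<noteq> x" "z = x" | "y \<noteq> x" "z \<noteq> x"
      using yz(3) by blast
    then show "?K y \<inter> ?K z = {}"
    proof cases
      case 1
      then show ?thesis using not_in_branch[OF E[OF yz(2)]] by simp
    next
      case 2
      then show ?thesis using not_in_branch[OF E[OF yz(1)]] by simp
    next
      case 3
      then show ?thesis using branch_disjoint[OF E[OF yz(1)] E[OF yz(2)] yz(3)] by simp
    qed
  qed
  have ind: "indep_vars (\<lambda>y. PiM (?K y) M) ?X (insert x N)"
    by (rule indep_vars_restrict[OF indep_states K disj])
  have A: "?A y \<in> sets (PiM (?K y) M)" if "y \<in> insert x N" for y
    using that meas[of y] pred_state[of x "{x}" "\<lambda>T. T = S"]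
    by (auto simp: pred_def)
  have pre: "?X y -` ?A y \<inter> space P = {\<omega> \<in> space P. ?Q y \<omega>}" if y: "y \<in> insert x N" for y
  proof -
    have "?X y \<omega> \<in> space (PiM (?K y) M)" if "\<omega> \<in> space P" for \<omega>
      using measurable_space[OF measurable_restrict_subset[OF K[OF y], of M]] that
      unfolding config_measure_def by blast
    moreover have "?Q y (?X y \<omega>) = ?Q y \<omega>" for \<omega>
      using y local[of y \<omega>] by auto
    ultimately show ?thesis by blast
  qed
  have fin: "finite N"
    using N finite_nbrs[OF x] finite_subset by blast
  have "prob (\<Inter>y\<in>insert x N. ?X y -` ?A y \<inter> space P) =
      (\<Prod>y\<in>insert x N. prob (?X y -` ?A y \<inter> space P))"
    by (rule indep_varsD_finite[OF ind _ _ A]) (use fin in auto)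
  also have "(\<Inter>y\<in>insert x N. ?X y -` ?A y \<inter> space P) =
      {\<omega> \<in> space P. \<omega> x = S \<and> (\<forall>y\<in>N. Q y \<omega>)}"
  proof -
    have "(\<Inter>y\<in>insert x N. ?X y -` ?A y \<inter> space P) =
        (\<Inter>y\<in>insert x N. {\<omega> \<in> space P. ?Q y \<omega>})"
      by (rule INF_cong[OF refl pre])
    also have "\<dots> = {\<omega> \<in> space P. \<omega> x = S \<and> (\<forall>y\<in>N. Q y \<omega>)}"
      using xN by (auto split: if_splits)
    finally show ?thesis .
  qed
  also have "(\<Prod>y\<in>insert x N. prob (?X y -` ?A y \<inter> space P)) =
      (\<Prod>y\<in>insert x N. prob {\<omega> \<in> space P. ?Q y \<omega>})"
    by (rule prod.cong[OF refl]) (simp only: pre)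
  also have "\<dots> = prob {\<omega> \<in> space P. \<omega> x = S} * (\<Prod>y\<in>N. prob {\<omega> \<in> space P. ?Q y \<omega>})"
    using fin xN by simp
  also have "(\<Prod>y\<in>N. prob {\<omega> \<in> space P. ?Q y \<omega>}) = (\<Prod>y\<in>N. prob {\<omega> \<in> space P. Q y \<omega>})"
  proof (rule prod.cong[OF refl])
    fix y assume "y \<in> N"
    then have "y \<noteq> x" using xN by blast
    then show "prob {\<omega> \<in> space P. ?Q y \<omega>} = prob {\<omega> \<in> space P. Q y \<omega>}"
      by (simp only: if_False)
  qed
  finally show ?thesis .
qed

lemma event_state: "x \<in> V \<Longrightarrow> {\<omega> \<in> space P. Q (\<omega> x)} \<in> events"
  using pred_state[of x V Q] by (simp add: config_measure_def pred_def)

lemma event_reach: "(u, x) \<in> E \<Longrightarrow> {\<omega> \<in> space P. reach (link E \<omega>) n u x} \<in> events"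
  using pred_reach[of u x n V] branch_subset by (simp add: config_measure_def pred_def)

section \<open>Survival probabilities of the two types and their recursion\<close>

definition reach_prob :: "nat \<Rightarrow> 'v \<Rightarrow> 'v \<Rightarrow> real" where
  "reach_prob n u x = prob {\<omega> \<in> space P. reach (link E \<omega>) n u x}"

text \<open>Here \<open>x\<close> is not selected by its parent \<open>u\<close>, so the link has to come from \<open>x\<close> itself.\<close>

definition back_prob :: "nat \<Rightarrow> 'v \<Rightarrow> 'v \<Rightarrow> real" where
  "back_prob n u x = prob {\<omega> \<in> space P. u \<in> \<omega> x \<and> reach (link E \<omega>) n u x}"

text \<open>By passing to the complement: survival fails iff it fails through every child
  independently. A child in \<open>S\<close> is linked anyway, whereas any other child must select
  \<open>x\<close> itself.\<close>

lemma prob_state_reach: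
  assumes ux: "(u, x) \<in> E" and S: "S \<subseteq> E `` {x}"
  shows "prob {\<omega> \<in> space P. \<omega> x = S \<and> reach (link E \<omega>) (Suc n) u x} =
    w (card S) * (1 - (\<Prod>y\<in>E `` {x} - {u}.
      if y \<in> S then 1 - reach_prob n x y else 1 - back_prob n x y))"
proof -
  let ?N = "E `` {x} - {u}"
  let ?Q = "\<lambda>y \<omega>. \<not> ((y \<in> S \<or> x \<in> \<omega> y) \<and> reach (link E \<omega>) n x y)"
  have x: "x \<in> V" using ux nbr_in_V by blast
  have ev: "{\<omega> \<in> space P. \<omega> x = S} \<in> events"
    using event_state[OF x, of "\<lambda>T. T = S"] .
  have evr: "{\<omega> \<in> space P. \<omega> x = S \<and> reach (link E \<omega>) (Suc n) u x} \<in> events"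
    using sets.Int[OF ev event_reach[OF ux, of "Suc n"]]
    by (simp add: Collect_conj_eq Int_ac del: reach.simps)
  have "prob {\<omega> \<in> space P. \<omega> x = S \<and> (\<forall>y\<in>?N. ?Q y \<omega>)} =
      prob {\<omega> \<in> space P. \<omega> x = S} * (\<Prod>y\<in>?N. prob {\<omega> \<in> space P. ?Q y \<omega>})"
  proof (rule prob_state_branches[OF x])
    fix y assume y: "y \<in> ?N"
    show "Measurable.pred (PiM (branch E n x y) M) (?Q y)"
      using y self_in_branch by (intro pred_intros_logic pred_state pred_reach) auto
    fix \<omega>
    show "?Q y (restrict \<omega> (branch E n x y)) = ?Q y \<omega>"
      using self_in_branch[of y E n x]
        reach_link_cong[of E n x y "restrict \<omega> (branch E n x y)" \<omega>] by simp
  qed auto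
  also have "{\<omega> \<in> space P. \<omega> x = S \<and> (\<forall>y\<in>?N. ?Q y \<omega>)} =
      {\<omega> \<in> space P. \<omega> x = S} - {\<omega> \<in> space P. \<omega> x = S \<and> reach (link E \<omega>) (Suc n) u x}"
    unfolding reach_link_Suc by blast
  also have "prob \<dots> = prob {\<omega> \<in> space P. \<omega> x = S} -
      prob {\<omega> \<in> space P. \<omega> x = S \<and> reach (link E \<omega>) (Suc n) u x}"
    by (rule finite_measure_Diff[OF ev evr]) blast
  also have "(\<Prod>y\<in>?N. prob {\<omega> \<in> space P. ?Q y \<omega>}) =
      (\<Prod>y\<in>?N. if y \<in> S then 1 - reach_prob n x y else 1 - back_prob n x y)"
  proof (rule prod.cong[OF refl])
    fix y assume "y \<in> ?N"
    then have xy: "(x, y) \<in> E" by auto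
    have r: "{\<omega> \<in> space P. reach (link E \<omega>) n x y} \<in> events"
      by (rule event_reach[OF xy])
    have b: "{\<omega> \<in> space P. x \<in> \<omega> y \<and> reach (link E \<omega>) n x y} \<in> events"
      using sets.Int[OF event_state[OF nbr_in_V(2)[OF xy], of "\<lambda>T. x \<in> T"] r]
      by (simp add: Collect_conj_eq Int_ac)
    show "prob {\<omega> \<in> space P. ?Q y \<omega>} = (if y \<in> S then 1 - reach_prob n x y else 1 - back_prob n x y)"
      using prob_neg[OF r] prob_neg[OF b] by (simp add: reach_prob_def back_prob_def)
  qed
  finally show ?thesis
    unfolding prob_state[OF x S] by (simp add: algebra_simps del: reach.simps)
qed

lemma prob_split_state:
  assumes x: "x \<in> V" and Q: "{\<omega> \<in> space P. Q \<omega>} \<in> events"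
  shows "prob {\<omega> \<in> space P. Q \<omega>} = (\<Sum>S\<in>Pow (E `` {x}). prob {\<omega> \<in> space P. \<omega> x = S \<and> Q \<omega>})"
proof -
  have ev: "{\<omega> \<in> space P. \<omega> x = S \<and> Q \<omega>} \<in> events" for S
    using sets.Int[OF event_state[OF x, of "\<lambda>T. T = S"] Q]
    by (simp add: Collect_conj_eq Int_ac)
  have "{\<omega> \<in> space P. Q \<omega>} = (\<Union>S\<in>Pow (E `` {x}). {\<omega> \<in> space P. \<omega> x = S \<and> Q \<omega>})"
    using config_subset[OF _ x] by auto
  also have "prob \<dots> = (\<Sum>S\<in>Pow (E `` {x}). prob {\<omega> \<in> space P. \<omega> x = S \<and> Q \<omega>})"
    by (rule finite_measure_finite_Union)
      (use finite_nbrs[OF x] ev in \<open>auto simp: disjoint_family_on_def\<close>)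
  finally show ?thesis .
qed

text \<open>A state consists of \<open>k\<close> of the \<open>d - 1\<close> children, with or
  without the parent, which is why the sizes \<open>k\<close> and \<open>Suc k\<close> appear
  together.\<close>

lemma sum_states:
  assumes ux: "(u, x) \<in> E"
  shows "(\<Sum>S\<in>Pow (E `` {x}). f (card (S - {u})) (card S)) =
    (\<Sum>k\<le>d - 1. real (d - 1 choose k) * (f k k + f k (Suc k) :: real))" (is ?th1)
  and "(\<Sum>S\<in>Pow (E `` {x}). if u \<in> S then f (card (S - {u})) (card S) else 0) =
    (\<Sum>k\<le>d - 1. real (d - 1 choose k) * f k (Suc k))" (is ?th2)
proof -
  have x: "x \<in> V" and u: "u \<in> E `` {x}"
    using ux nbr_in_V sym by (auto dest: symD)
  let ?N = "E `` {x} - {u}"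
  have fin: "finite (E `` {x})" and card: "card ?N = d - 1"
    using finite_nbrs[OF x] regular[OF x] u by auto
  have T: "T - {u} = T" "u \<notin> T" "insert u T - {u} = T" "card (insert u T) = Suc (card T)"
    if "T \<in> Pow ?N" for T
  proof -
    have "finite T" "u \<notin> T"
      using that finite_subset[OF _ fin] by auto
    then show "T - {u} = T" "u \<notin> T" "insert u T - {u} = T" "card (insert u T) = Suc (card T)"
      by auto
  qed
  have "(\<Sum>S\<in>Pow (E `` {x}). f (card (S - {u})) (card S)) =
      (\<Sum>T\<in>Pow ?N. f (card T) (card T) + f (card T) (Suc (card T)))"
    unfolding sum_Pow_remove[OF fin u] by (rule sum.cong[OF refl]) (simp only: T)
  also have "\<dots> = (\<Sum>k\<le>d - 1. real (d - 1 choose k) * (f k k + f k (Suc k)))"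
    using sum_Pow_card[of ?N "\<lambda>k. f k k + f k (Suc k)"] fin by (simp add: card)
  finally show ?th1 .
  have "(\<Sum>S\<in>Pow (E `` {x}). if u \<in> S then f (card (S - {u})) (card S) else 0) =
      (\<Sum>T\<in>Pow ?N. f (card T) (Suc (card T)))"
    unfolding sum_Pow_remove[OF fin u]
    by (rule sum.cong[OF refl]) (simp only: T insertI1 if_True if_False add_0)
  also have "\<dots> = (\<Sum>k\<le>d - 1. real (d - 1 choose k) * f k (Suc k))"
    using sum_Pow_card[of ?N "\<lambda>k. f k (Suc k)"] fin by (simp add: card)
  finally show ?th2 .
qed

lemma sum_weights:
  assumes "(u, x) \<in> E"
  shows "(\<Sum>k\<le>d - 1. real (d - 1 choose k) * (w k + w (Suc k))) = 1"
proof -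
  have x: "x \<in> V" using assms nbr_in_V by blast
  have "1 = (\<Sum>S\<in>Pow (E `` {x}). w (card S))"
    using prob_split_state[OF x, of "\<lambda>_. True"] prob_state[OF x] by (simp add: prob_space)
  then show ?thesis
    using sum_states(1)[OF assms, of "\<lambda>_. w"] by simp
qed

text \<open>Together with \<open>step_back\<close> this is the map \<open>F\<close>;
  \<open>k\<close> is the number of selected children. A vertex already linked to its parent may
  select it or not, hence \<open>w k + w (Suc k)\<close>; for \<open>step_back\<close> it has to,
  hence only \<open>w (Suc k)\<close>.\<close>

definition step_reach :: "real \<Rightarrow> real \<Rightarrow> real" where
  "step_reach a b = (\<Sum>k\<le>d - 1. real (d - 1 choose k) * (w k + w (Suc k)) *
     (1 - (1 - a) ^ k * (1 - b) ^ (d - 1 - k)))"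

definition step_back :: "real \<Rightarrow> real \<Rightarrow> real" where
  "step_back a b = (\<Sum>k\<le>d - 1. real (d - 1 choose k) * w (Suc k) *
     (1 - (1 - a) ^ k * (1 - b) ^ (d - 1 - k)))"

text \<open>At depth 0 nothing is required of the first type, and of the second only that the vertex
  selects its parent.\<close>

primrec surv :: "nat \<Rightarrow> real \<times> real" where
  "surv 0 = (1, \<Sum>k\<le>d - 1. real (d - 1 choose k) * w (Suc k))"
| "surv (Suc n) =
    (step_reach (fst (surv n)) (snd (surv n)), step_back (fst (surv n)) (snd (surv n)))"

text \<open>The recursion shows by induction that these probabilities are the same for all edges of
  the tree, although no automorphisms are used.\<close>

lemma surv_eq: "(u, x) \<in> E \<Longrightarrow> surv n = (reach_prob n u x, back_prob n u x)"
proof (induction n arbitrary: u x)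
  case 0
  have x: "x \<in> V" using 0 nbr_in_V by blast
  have "back_prob 0 u x = (\<Sum>S\<in>Pow (E `` {x}). prob {\<omega> \<in> space P. \<omega> x = S \<and> u \<in> \<omega> x})"
    using prob_split_state[OF x event_state[OF x, of "\<lambda>T. u \<in> T"]] by (simp add: back_prob_def)
  also have "\<dots> = (\<Sum>S\<in>Pow (E `` {x}). if u \<in> S then w (card S) else 0)"
  proof (rule sum.cong[OF refl])
    fix S assume "S \<in> Pow (E `` {x})"
    moreover have "{\<omega> \<in> space P. \<omega> x = S \<and> u \<in> \<omega> x} =
        (if u \<in> S then {\<omega> \<in> space P. \<omega> x = S} else {})" by auto
    ultimately show "prob {\<omega> \<in> space P. \<omega> x = S \<and> u \<in> \<omega> x} = (if u \<in> S then w (card S) else 0)"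
      using prob_state[OF x] by simp
  qed
  also have "\<dots> = (\<Sum>k\<le>d - 1. real (d - 1 choose k) * w (Suc k))"
    using sum_states(2)[OF 0, of "\<lambda>_. w"] .
  finally show ?case
    by (simp add: reach_prob_def prob_space)
next
  case (Suc n)
  obtain a b where ab: "surv n = (a, b)" by (cases "surv n")
  have x: "x \<in> V" using Suc.prems nbr_in_V by blast
  let ?N = "E `` {x} - {u}" and ?D = "d - 1"
  have u: "u \<in> E `` {x}" using Suc.prems sym by (auto dest: symD)
  have fin: "finite (E `` {x})" and card: "card ?N = ?D"
    using finite_nbrs[OF x] regular[OF x] u by auto
  let ?g = "\<lambda>k. 1 - (1 - a) ^ k * (1 - b) ^ (?D - k)"
  have state: "prob {\<omega> \<in> space P. \<omega> x = S \<and> reach (link E \<omega>) (Suc n) u x} =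
      w (card S) * ?g (card (S - {u}))" if S: "S \<in> Pow (E `` {x})" for S
  proof -
    \<comment> \<open>By induction all children share the same pair \<open>(a, b)\<close>, so the
      product depends only on how many of them are selected.\<close>
    have "reach_prob n x y = a" "back_prob n x y = b" if "y \<in> ?N" for y
      using Suc.IH[of x y] ab that by auto
    then have "(\<Prod>y\<in>?N. if y \<in> S then 1 - reach_prob n x y else 1 - back_prob n x y) =
        (\<Prod>y\<in>?N. if y \<in> S then 1 - a else 1 - b)"
      by (intro prod.cong) auto
    also have "\<dots> = (1 - a) ^ card (?N \<inter> S) * (1 - b) ^ card (?N \<inter> - S)"
      using fin by (subst prod.If_cases) auto
    also have "?N \<inter> S = S - {u}" using S by auto
    also have "?N \<inter> - S = ?N - (S - {u})" by auto
    also have "card (?N - (S - {u})) = ?D - card (S - {u})"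
      using S fin card by (subst card_Diff_subset) (auto intro: finite_subset)
    finally show ?thesis
      using prob_state_reach[OF Suc.prems, of S n] S by simp
  qed
  have evr: "{\<omega> \<in> space P. reach (link E \<omega>) (Suc n) u x} \<in> events"
    by (rule event_reach[OF Suc.prems])
  have evb: "{\<omega> \<in> space P. u \<in> \<omega> x \<and> reach (link E \<omega>) (Suc n) u x} \<in> events"
    using sets.Int[OF event_state[OF x, of "\<lambda>T. u \<in> T"] evr]
    by (simp add: Collect_conj_eq Int_ac del: reach.simps)
  have "reach_prob (Suc n) u x = (\<Sum>S\<in>Pow (E `` {x}). w (card S) * ?g (card (S - {u})))"
    unfolding reach_prob_def prob_split_state[OF x evr] by (rule sum.cong[OF refl state])
  then have r: "reach_prob (Suc n) u x =
      (\<Sum>k\<le>?D. real (?D choose k) * (w k + w (Suc k)) * ?g k)"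
    using sum_states(1)[OF Suc.prems, of "\<lambda>i j. w j * ?g i"] by (simp add: algebra_simps)
  have "back_prob (Suc n) u x =
      (\<Sum>S\<in>Pow (E `` {x}). if u \<in> S then w (card S) * ?g (card (S - {u})) else 0)"
    unfolding back_prob_def prob_split_state[OF x evb]
  proof (rule sum.cong[OF refl])
    fix S assume S: "S \<in> Pow (E `` {x})"
    have "{\<omega> \<in> space P. \<omega> x = S \<and> u \<in> \<omega> x \<and> reach (link E \<omega>) (Suc n) u x} =
        (if u \<in> S then {\<omega> \<in> space P. \<omega> x = S \<and> reach (link E \<omega>) (Suc n) u x} else {})"
      by auto
    then show "prob {\<omega> \<in> space P. \<omega> x = S \<and> u \<in> \<omega> x \<and> reach (link E \<omega>) (Suc n) u x} =
        (if u \<in> S then w (card S) * ?g (card (S - {u})) else 0)"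
      using state[OF S] by (simp del: reach.simps)
  qed
  then have "back_prob (Suc n) u x = (\<Sum>k\<le>?D. real (?D choose k) * w (Suc k) * ?g k)"
    using sum_states(2)[OF Suc.prems, of "\<lambda>i j. w j * ?g i"] by (simp add: algebra_simps)
  then show ?case using r ab by (simp add: step_reach_def step_back_def)
qed

end

subsection \<open>The critical value\<close>

text \<open>A union bound in algebraic form: \<open>1 - X * Y = (1 - X) + X * (1 - Y)\<close>, with
  Bernoulli's inequality for both powers and \<open>X \<le> 1\<close>.\<close>

lemma one_minus_prod_powers_le:
  fixes a b :: real
  assumes "0 \<le> a" "a \<le> 1" "0 \<le> b" "b \<le> 1"
  shows "1 - (1 - a) ^ k * (1 - b) ^ m \<le> k * a + m * b"
proof -
  have X: "1 - k * a \<le> (1 - a) ^ k" "(1 - a) ^ k \<le> 1" "0 \<le> (1 - a) ^ k"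
    using Bernoulli_inequality[of "- a" k] assms by (auto intro: power_le_one)
  have Y: "1 - m * b \<le> (1 - b) ^ m" "(1 - b) ^ m \<le> 1"
    using Bernoulli_inequality[of "- b" m] assms by (auto intro: power_le_one)
  have "(1 - a) ^ k * (1 - (1 - b) ^ m) \<le> 1 * (1 - (1 - b) ^ m)"
    using X Y by (intro mult_right_mono) auto
  then show ?thesis using X Y by (simp add: algebra_simps)
qed

text \<open>Splitting off one factor before applying Bernoulli's inequality leaves the quadratic
  surplus \<open>l * b * b\<close>, positive because \<open>m \<ge> 2\<close>. This strictness
  settles the critical case.\<close>

lemma one_minus_power_less:
  fixes b :: real
  assumes "0 < b" "b \<le> 1" "2 \<le> m"
  shows "1 - (1 - b) ^ m < m * b"
proof -
  obtain l where m: "m = Suc l" "1 \<le> l" using assms(3) by (cases m) auto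
  have "(1 - b) * (1 - l * b) \<le> (1 - b) * (1 - b) ^ l"
    using Bernoulli_inequality[of "- b" l] assms by (intro mult_left_mono) auto
  moreover have "0 < l * b * b" using assms m by simp
  ultimately show ?thesis by (simp add: m algebra_simps)
qed

text \<open>The equations are those of a fixed point, multiplied by \<open>d = D + 1\<close>.
  Linearising them gives \<open>(1 - p * D) * a \<le> D * (D - p) * b\<close> and, if
  \<open>b > 0\<close>, strictly \<open>(1 - p * (D - 2)) * b < 2 * p * a\<close>. Combining the two
  contradicts the sign of the determinant.\<close>

lemma critical_fixed_point:
  fixes p a b :: real and D :: nat
  assumes D: "2 \<le> D" and p: "0 \<le> p" "p < 1" "p * D < 1"
    and crit: "0 \<le> (1 - p * D) * (1 - p * (real D - 2)) - 2 * p * D * (D - p)"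
    and ab: "0 \<le> a" "a \<le> 1" "0 \<le> b" "b \<le> 1"
    and a: "(D + 1) * a = (1 - p) * (1 - (1 - b) ^ D) +
      (D * (1 - p) + 2 * p) * (1 - (1 - a) * (1 - b) ^ (D - 1)) +
      (real D - 1) * p * (1 - (1 - a)\<^sup>2 * (1 - b) ^ (D - 2))"
    and b: "(D + 1) * b = (1 - p) * (1 - (1 - b) ^ D) + 2 * p * (1 - (1 - a) * (1 - b) ^ (D - 1))"
  shows "a = 0"
proof -
  have D1: "real (D - 1) = real D - 1" "real (D - Suc 0) = real D - 1" "real (D - 2) = real D - 2"
    using D by auto
  have l0: "1 - (1 - b) ^ D \<le> D * b"
    using one_minus_prod_powers_le[OF ab, of 0 D] by simp
  have l1: "1 - (1 - a) * (1 - b) ^ (D - 1) \<le> a + (real D - 1) * b"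
    using one_minus_prod_powers_le[OF ab, of 1 "D - 1"] by (simp add: D1)
  have l2: "1 - (1 - a)\<^sup>2 * (1 - b) ^ (D - 2) \<le> 2 * a + (real D - 2) * b"
    using one_minus_prod_powers_le[OF ab, of 2 "D - 2"] by (simp add: D1)
  have m1: "2 * p * (1 - (1 - a) * (1 - b) ^ (D - 1)) \<le> 2 * p * (a + (real D - 1) * b)"
    using l1 p by (intro mult_left_mono) auto
  have m1': "(D * (1 - p) + 2 * p) * (1 - (1 - a) * (1 - b) ^ (D - 1)) \<le>
      (D * (1 - p) + 2 * p) * (a + (real D - 1) * b)"
    using l1 p by (intro mult_left_mono) auto
  have m0: "(1 - p) * (1 - (1 - b) ^ D) \<le> (1 - p) * (D * b)"
    using l0 p by (intro mult_left_mono) auto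
  have m2: "(real D - 1) * p * (1 - (1 - a)\<^sup>2 * (1 - b) ^ (D - 2)) \<le>
      (real D - 1) * p * (2 * a + (real D - 2) * b)"
    using l2 p D by (intro mult_left_mono) auto
  have A: "(1 - p * D) * a \<le> D * (D - p) * b"
    using m0 m1' m2 a by (simp add: algebra_simps)
  have "b = 0"
  proof (rule ccontr)
    assume "b \<noteq> 0"
    then have b0: "0 < b" using ab by simp
    \<comment> \<open>The one strict estimate; its weight \<open>1 - p\<close> is positive, also at
      the critical value.\<close>
    have "(1 - p) * (1 - (1 - b) ^ D) < (1 - p) * (D * b)"
      using one_minus_power_less[OF b0 ab(4) D] p by (intro mult_strict_left_mono) auto
    then have B: "(1 - p * (real D - 2)) * b < 2 * p * a"
      using m1 b by (simp add: algebra_simps)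
    have "(1 - p * D) * ((1 - p * (real D - 2)) * b) < (1 - p * D) * (2 * p * a)"
      using B p by (intro mult_strict_left_mono) auto
    also have "\<dots> = 2 * p * ((1 - p * D) * a)" by simp
    also have "\<dots> \<le> 2 * p * (D * (D - p) * b)"
      using A p by (intro mult_left_mono) auto
    finally have "((1 - p * D) * (1 - p * (real D - 2)) - 2 * p * D * (D - p)) * b < 0"
      by (simp add: algebra_simps)
    then show False
      using crit b0 by (simp add: mult_less_0_iff)
  qed
  then have "(1 - p * D) * a \<le> 0" using A by simp
  then show ?thesis using p ab by (simp add: mult_le_0_iff)
qed

text \<open>Provides the vector \<open>(t, 1)\<close> that the linearisation enlarges in both
  components. A negative determinant says exactly that the lower bound for \<open>t\<close> is below
  the upper one; if \<open>1 - p * D \<le> 0\<close>, there is no upper bound.\<close>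

lemma supercritical_direction:
  fixes p D :: real
  assumes D: "2 \<le> D" and p: "0 < p" "p \<le> 1"
    and crit: "(1 - p * D) * (1 - p * (D - 2)) - 2 * p * D * (D - p) < 0"
  shows "\<exists>t>0. 1 - p * (D - 2) < 2 * p * t \<and> (1 - p * D) * t < D * (D - p)"
proof -
  have DD: "0 < D * (D - p)" using D p by simp
  let ?s = "(1 - p * (D - 2)) / (2 * p)"
  have s: "1 - p * (D - 2) < 2 * p * t \<longleftrightarrow> ?s < t" for t
    using p by (simp add: field_simps)
  show ?thesis
  proof (cases "1 - p * D \<le> 0")
    case True
    have "(1 - p * D) * (max ?s 0 + 1) \<le> 0"
      using True by (simp add: mult_nonpos_nonneg)
    then show ?thesis
      using DD by (intro exI[of _ "max ?s 0 + 1"]) (auto simp: s simp del: max_less_iff_conj)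
  next
    case False
    have "?s < D * (D - p) / (1 - p * D)"
      using False p crit by (simp add: field_simps)
    moreover have "0 < D * (D - p) / (1 - p * D)"
      using False DD by simp
    ultimately obtain t where t: "max ?s 0 < t" "t < D * (D - p) / (1 - p * D)"
      using dense[of "max ?s 0"] by (metis max_less_iff_conj)
    then have "0 < t" "?s < t" "(1 - p * D) * t < D * (D - p)"
      using False by (simp_all add: field_simps)
    then show ?thesis
      unfolding s by blast
  qed
qed

text \<open>Along the ray \<open>(t * e, e)\<close> the excess in each inequality vanishes at
  \<open>e = 0\<close> and has a positive derivative there, by the choice of \<open>t\<close>. The
  bound \<open>c\<close> will be the initial value of the second survival probability.\<close>

lemma supercritical_subsolution:
  fixes p c :: real and D :: nat
  assumes D: "2 \<le> D" and p: "0 < p" "p \<le> 1" and c: "0 < c"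
    and crit: "(1 - p * D) * (1 - p * (real D - 2)) - 2 * p * D * (D - p) < 0"
  shows "\<exists>(a :: real) (b :: real). 0 < a \<and> a \<le> 1 \<and> 0 < b \<and> b \<le> 1 \<and> b \<le> c \<and>
    (D + 1) * a \<le> (1 - p) * (1 - (1 - b) ^ D) +
      (D * (1 - p) + 2 * p) * (1 - (1 - a) * (1 - b) ^ (D - 1)) +
      (real D - 1) * p * (1 - (1 - a)\<^sup>2 * (1 - b) ^ (D - 2)) \<and>
    (D + 1) * b \<le> (1 - p) * (1 - (1 - b) ^ D) + 2 * p * (1 - (1 - a) * (1 - b) ^ (D - 1))"
proof -
  have D1: "real (D - 1) = real D - 1" "real (D - Suc 0) = real D - 1" "real (D - 2) = real D - 2"
    using D by auto
  obtain t where t: "0 < t" "1 - p * (real D - 2) < 2 * p * t" "(1 - p * D) * t < D * (D - p)"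
    using supercritical_direction[of "real D" p] D p crit by auto
  let ?f = "\<lambda>e :: real. (1 - p) * (1 - (1 - e) ^ D) +
      (D * (1 - p) + 2 * p) * (1 - (1 - t * e) * (1 - e) ^ (D - 1)) +
      (real D - 1) * p * (1 - (1 - t * e)\<^sup>2 * (1 - e) ^ (D - 2)) - (D + 1) * (t * e)"
  let ?g = "\<lambda>e :: real. (1 - p) * (1 - (1 - e) ^ D) + 2 * p * (1 - (1 - t * e) * (1 - e) ^ (D - 1)) - (D + 1) * e"
  have "(?f has_real_derivative (1 - p) * D + (D * (1 - p) + 2 * p) * (t + (real D - 1)) +
      (real D - 1) * p * (2 * t + (real D - 2)) - (D + 1) * t) (at 0)"
    by (auto intro!: derivative_eq_intros simp: D1 algebra_simps)
  moreover have "0 < (1 - p) * D + (D * (1 - p) + 2 * p) * (t + (real D - 1)) +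
      (real D - 1) * p * (2 * t + (real D - 2)) - (D + 1) * t"
    using t(3) by (simp add: algebra_simps)
  ultimately obtain e1 where e1: "0 < e1" "\<And>h. 0 < h \<Longrightarrow> h < e1 \<Longrightarrow> ?f 0 < ?f (0 + h)"
    using DERIV_pos_inc_right by blast
  have "(?g has_real_derivative (1 - p) * D + 2 * p * (t + (real D - 1)) - (D + 1)) (at 0)"
    by (auto intro!: derivative_eq_intros simp: D1 algebra_simps)
  moreover have "0 < (1 - p) * D + 2 * p * (t + (real D - 1)) - (D + 1)"
    using t(2) by (simp add: algebra_simps)
  ultimately obtain e2 where e2: "0 < e2" "\<And>h. 0 < h \<Longrightarrow> h < e2 \<Longrightarrow> ?g 0 < ?g (0 + h)"
    using DERIV_pos_inc_right by blast
  \<comment> \<open>Here \<open>e1\<close> and \<open>e2\<close> keep the excesses positive,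
    \<open>1 / t\<close> ensures \<open>a \<le> 1\<close>, and the last two entries bound
    \<open>b\<close>.\<close>
  have "0 < Min {e1, e2, 1 / t, 1, c}"
    using e1(1) e2(1) t(1) c by simp
  then obtain e where e: "0 < e" "e < Min {e1, e2, 1 / t, 1, c}"
    using dense by blast
  then have "?f 0 < ?f (0 + e)" "?g 0 < ?g (0 + e)" "e < 1 / t" "e < 1" "e < c"
    using e1(2) e2(2) by auto
  then have "0 < ?f e" "0 < ?g e" "t * e \<le> 1"
    using t(1) by (simp_all add: less_divide_eq mult.commute)
  then show ?thesis
    using \<open>e < 1\<close> \<open>e < c\<close> e(1) t(1)
    by (intro exI[of _ "t * e"] exI[of _ e] conjI) simp_all
qed

section \<open>Analysis of the explicit formula\<close>

lemma pc2_expand: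
  assumes "3 \<le> d"
  obtains K s where "K = (real d)\<^sup>2 - real d - 1" "pc2 d = 1 / (K + s)" "0 < s"
    "s\<^sup>2 = K\<^sup>2 - (real d - 1)\<^sup>2" "3 \<le> real d" "real d - 1 < K"
proof -
  define K where "K = (real d)\<^sup>2 - real d - 1"
  define s where "s = sqrt (K\<^sup>2 - (real d - 1)\<^sup>2)"
  have d: "3 \<le> real d" using assms by simp
  have "real d * 3 \<le> real d * real d" using d by (intro mult_left_mono) auto
  then have K: "real d - 1 < K" using d by (simp add: K_def power2_eq_square)
  then have "(real d - 1)\<^sup>2 < K\<^sup>2" using d by (intro power_strict_mono) auto
  then have "0 < s" "s\<^sup>2 = K\<^sup>2 - (real d - 1)\<^sup>2" by (auto simp: s_def)
  moreover have "pc2 d = 1 / (K + s)" by (simp add: pc2_def K_def s_def)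
  ultimately show thesis using that d K K_def by blast
qed

lemma pc2_bounds:
  assumes "3 \<le> d"
  shows "0 < pc2 d" "pc2 d * (real d - 1) < 1" "pc2 d < 1"
proof -
  obtain K s where e: "pc2 d = 1 / (K + s)" "0 < s" "3 \<le> real d" "real d - 1 < K"
    using pc2_expand[OF assms] by metis
  show "0 < pc2 d" using e by simp
  show *: "pc2 d * (real d - 1) < 1"
    unfolding e(1) using e(2-4) by (simp add: divide_less_eq)
  have "pc2 d * 1 \<le> pc2 d * (real d - 1)"
    using e(3) \<open>0 < pc2 d\<close> by (intro mult_left_mono) auto
  then show "pc2 d < 1" using * by simp
qed

text \<open>The determinant factors as \<open>(1 - p * (K + s)) * (1 - p * (K - s))\<close>. As
  \<open>K - s < 1\<close>, the second factor is positive on the unit interval, and the first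
  changes sign at \<open>pc2 d\<close>.\<close>

lemma pc2_less_iff:
  fixes p :: real
  assumes d: "3 \<le> d" and p: "0 \<le> p" "p \<le> 1" and D: "d = D + 1"
  shows "pc2 d < p \<longleftrightarrow> (1 - p * D) * (1 - p * (real D - 2)) - 2 * p * D * (D - p) < 0"
proof -
  obtain K s where K_def: "K = (real d)\<^sup>2 - real d - 1"
    and e: "pc2 d = 1 / (K + s)" "0 < s" "s\<^sup>2 = K\<^sup>2 - (real d - 1)\<^sup>2" "3 \<le> real d" "real d - 1 < K"
    using pc2_expand[OF d] by metis
  \<comment> \<open>The product is \<open>(d - 1)\<^sup>2 = K - (d - 2)\<close>, hence smaller than
    \<open>K + s\<close>.\<close>
  have "(K - s) * (K + s) < 1 * (K + s)"
  proof -
    have "(K - s) * (K + s) = (real d - 1) * (real d - 1)"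
      using e(3) by (simp add: algebra_simps power2_eq_square)
    also have "(real d - 1) * (real d - 1) = K - (real d - 2)"
      by (simp add: K_def power2_eq_square algebra_simps)
    also have "\<dots> < K + s" using e by simp
    finally show ?thesis by simp
  qed
  then have Ks: "K - s < 1"
    using e by (subst (asm) mult_less_cancel_right_pos) auto
  have "p * (K - s) < 1"
  proof (cases "K - s \<le> 0")
    case True
    then have "p * (K - s) \<le> 0" using p by (simp add: mult_nonneg_nonpos)
    then show ?thesis by simp
  next
    case False
    then have "p * (K - s) \<le> 1 * (K - s)" using p by (intro mult_right_mono) auto
    then show ?thesis using Ks by simp
  qed
  moreover have "(1 - p * D) * (1 - p * (real D - 2)) - 2 * p * D * (D - p) =
      (1 - p * (K + s)) * (1 - p * (K - s))"
  proof -
    have "(1 - p * (K + s)) * (1 - p * (K - s)) = 1 - 2 * p * K + p\<^sup>2 * (K\<^sup>2 - s\<^sup>2)"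
      by (simp add: algebra_simps power2_eq_square)
    also have "\<dots> = 1 - 2 * p * ((real D)\<^sup>2 + real D - 1) + p\<^sup>2 * (real D)\<^sup>2"
    proof -
      have "K\<^sup>2 - s\<^sup>2 = (real D)\<^sup>2" using e(3) D by simp
      moreover have "K = (real D)\<^sup>2 + real D - 1"
        unfolding K_def D by (simp add: power2_eq_square algebra_simps)
      ultimately show ?thesis by simp
    qed
    finally show ?thesis by (simp add: algebra_simps power2_eq_square)
  qed
  moreover have "pc2 d < p \<longleftrightarrow> 1 - p * (K + s) < 0"
    unfolding e(1) using e(2,4,5) by (simp add: divide_less_eq)
  ultimately show ?thesis by (simp add: mult_less_0_iff)
qed

text \<open>The denominator increases: \<open>K\<close> does so strictly, and the radicand is the
  product of the increasing factors \<open>d\<close>, \<open>d - 2\<close> and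
  \<open>d\<^sup>2 - 2\<close>.\<close>

lemma pc2_strict_antimono: "strict_antimono_on {3..} pc2"
proof (rule monotone_onI)
  fix m n :: nat assume mn: "m \<in> {3..}" "n \<in> {3..}" "m < n"
  define K where "K d = (real d)\<^sup>2 - real d - 1" for d
  have fac: "K d = real d * (real d - 1) - 1"
    "(K d)\<^sup>2 - (real d - 1)\<^sup>2 = (real d * (real d - 2)) * ((real d)\<^sup>2 - 2)" for d
    by (simp_all add: K_def power2_eq_square algebra_simps)
  have r: "3 \<le> real m" "real m < real n" using mn by auto
  have "real m * (real m - 1) < real n * (real n - 1)"
    using r by (intro mult_strict_mono) auto
  then have "K m < K n" by (simp add: fac)
  moreover have "(real m * (real m - 2)) * ((real m)\<^sup>2 - 2) \<le> (real n * (real n - 2)) * ((real n)\<^sup>2 - 2)"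
  proof (intro mult_mono)
    have "3 * 3 \<le> real m * real m" using r by (intro mult_mono) auto
    then show "0 \<le> (real m)\<^sup>2 - 2" by (simp add: power2_eq_square)
    show "(real m)\<^sup>2 - 2 \<le> (real n)\<^sup>2 - 2" using r by (simp add: power_mono)
  qed (use r in auto)
  then have "sqrt ((K m)\<^sup>2 - (real m - 1)\<^sup>2) \<le> sqrt ((K n)\<^sup>2 - (real n - 1)\<^sup>2)"
    by (simp add: fac(2))
  moreover have "0 < K m + sqrt ((K m)\<^sup>2 - (real m - 1)\<^sup>2)"
  proof -
    have "3 * 2 \<le> real m * (real m - 1)" using r by (intro mult_mono) auto
    then have "0 < K m" by (simp add: fac(1))
    moreover have "0 \<le> sqrt ((K m)\<^sup>2 - (real m - 1)\<^sup>2)"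
      using pc2_expand[of m] mn by (metis K_def atLeast_iff less_imp_le real_sqrt_ge_zero zero_le_power2)
    ultimately show ?thesis by (rule add_pos_nonneg)
  qed
  ultimately show "pc2 m > pc2 n"
    unfolding pc2_def K_def[symmetric]
    by (intro divide_strict_left_mono mult_pos_pos add_less_le_mono) (auto intro: less_trans add_less_le_mono simp del: real_sqrt_le_iff)
qed

lemma pc2_asymp: "pc2 \<sim>[at_top] (\<lambda>d. 1 / (2 * (real d)\<^sup>2))"
  unfolding pc2_def by real_asymp

subsection \<open>Percolation on the tree\<close>

context percolation
begin

text \<open>Read off from inclusions between the events behind these numbers rather than from the
  recursion.\<close>

lemma surv_bounds:
  assumes e: "(u, x) \<in> E"
  shows "0 \<le> snd (surv n)" "snd (surv n) \<le> fst (surv n)" "fst (surv n) \<le> 1"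
    "fst (surv (Suc n)) \<le> fst (surv n)" "snd (surv (Suc n)) \<le> snd (surv n)"
proof -
  have x: "x \<in> V" using e nbr_in_V by blast
  have r: "{\<omega> \<in> space P. reach (link E \<omega>) n u x} \<in> events" for n
    by (rule event_reach[OF e])
  have b: "{\<omega> \<in> space P. u \<in> \<omega> x \<and> reach (link E \<omega>) n u x} \<in> events" for n
    using sets.Int[OF event_state[OF x, of "\<lambda>T. u \<in> T"] r]
    by (simp add: Collect_conj_eq Int_ac)
  show "0 \<le> snd (surv n)" "snd (surv n) \<le> fst (surv n)" "fst (surv n) \<le> 1"
    "fst (surv (Suc n)) \<le> fst (surv n)" "snd (surv (Suc n)) \<le> snd (surv n)"
    unfolding surv_eq[OF e] reach_prob_def back_prob_def fst_conv snd_conv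
    using reach_Suc_imp_reach
    by (auto intro!: finite_measure_mono r b simp del: reach.simps(2))
qed

lemma step_mono:
  assumes "0 \<le> a" "a \<le> a'" "a' \<le> 1" "0 \<le> b" "b \<le> b'" "b' \<le> 1" "0 < d"
  shows "step_reach a b \<le> step_reach a' b'" "step_back a b \<le> step_back a' b'"
proof -
  have *: "1 - (1 - a) ^ k * (1 - b) ^ m \<le> 1 - (1 - a') ^ k * (1 - b') ^ m" for k m :: nat
  proof -
    have "(1 - a') ^ k * (1 - b') ^ m \<le> (1 - a) ^ k * (1 - b) ^ m"
      using assms by (intro mult_mono power_mono) auto
    then show ?thesis by simp
  qed
  show "step_reach a b \<le> step_reach a' b'" "step_back a b \<le> step_back a' b'"
    unfolding step_reach_def step_back_def
    using \<open>0 < d\<close> by (auto intro!: sum_mono mult_left_mono * add_nonneg_nonneg mult_nonneg_nonneg w_nonneg)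
qed

section \<open>From survival of branches to percolation at the root\<close>

definition reach_event :: "'v \<Rightarrow> nat \<Rightarrow> ('v \<Rightarrow> 'v set) set" where
  "reach_event r n =
     {\<omega> \<in> space P. \<exists>y\<in>E `` {r}. (y \<in> \<omega> r \<or> r \<in> \<omega> y) \<and> reach (link E \<omega>) n r y}"

lemma reach_event_antimono: "m \<le> n \<Longrightarrow> reach_event r n \<subseteq> reach_event r m"
proof
  fix \<omega> assume "m \<le> n" "\<omega> \<in> reach_event r n"
  then obtain y where y: "\<omega> \<in> space P" "y \<in> E `` {r}" "y \<in> \<omega> r \<or> r \<in> \<omega> y" "reach (link E \<omega>) n r y"
    unfolding reach_event_def by blast
  have "reach (link E \<omega>) m r y"
    by (rule reach_antimono[OF \<open>m \<le> n\<close> y(4)])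
  then show "\<omega> \<in> reach_event r m"
    using y unfolding reach_event_def by blast
qed

lemma event_reach_event: "r \<in> V \<Longrightarrow> reach_event r n \<in> events"
proof -
  assume r: "r \<in> V"
  have "Measurable.pred (PiM V M) (\<lambda>\<omega>. \<exists>y\<in>E `` {r}. (y \<in> \<omega> r \<or> r \<in> \<omega> y) \<and> reach (link E \<omega>) n r y)"
    using r nbr_in_V branch_subset finite_nbrs
    by (intro pred_intros_finite pred_intros_logic pred_state pred_reach) auto
  then show ?thesis by (simp add: reach_event_def config_measure_def pred_def)
qed

text \<open>Continuity from above: these events decrease to the event that the cluster of the root
  is infinite.\<close>

lemma theta_limit:
  assumes r: "r \<in> V"
  shows "(\<lambda>n. prob (reach_event r n)) \<longlonglongrightarrow> theta d V E r p"
proof -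
  have "(\<lambda>n. prob (reach_event r n)) \<longlonglongrightarrow> prob (\<Inter>n. reach_event r n)"
    by (rule finite_Lim_measure_decseq)
      (auto simp: event_reach_event[OF r] decseq_def intro: reach_event_antimono[THEN subsetD])
  also have "(\<Inter>n. reach_event r n) = {\<omega> \<in> space P. infinite (cluster V \<omega> r)}"
  proof -
    have "infinite (cluster V \<omega> r) \<longleftrightarrow> (\<forall>n. \<omega> \<in> reach_event r n)" if "\<omega> \<in> space P" for \<omega>
    proof -
      have "(\<exists>y. (r, y) \<in> link E \<omega> \<and> reach (link E \<omega>) n r y) \<longleftrightarrow> \<omega> \<in> reach_event r n" for n
        using that unfolding reach_event_def link_def by blast
      then show ?thesis
        using infinite_cluster_iff[OF config_subset[OF that] r] by (simp only:)
    qed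
    moreover have "reach_event r n \<subseteq> space P" for n
      by (auto simp: reach_event_def)
    ultimately show ?thesis by blast
  qed
  finally show ?thesis
    by (simp add: theta_def)
qed

text \<open>A union bound over the \<open>d\<close> neighbours of the root, ignoring whether the
  root is linked to them.\<close>

lemma theta_le:
  assumes r: "r \<in> V"
  shows "theta d V E r p \<le> d * fst (surv n)"
proof -
  have "theta d V E r p \<le> prob (reach_event r n)"
  proof (rule LIMSEQ_le_const2[OF theta_limit[OF r]], intro exI[of _ n] allI impI)
    fix m assume "n \<le> m"
    then show "prob (reach_event r m) \<le> prob (reach_event r n)"
      by (intro finite_measure_mono reach_event_antimono event_reach_event r)
  qed
  also have "\<dots> \<le> prob (\<Union>y\<in>E `` {r}. {\<omega> \<in> space P. reach (link E \<omega>) n r y})"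
  proof (rule finite_measure_mono)
    show "reach_event r n \<subseteq> (\<Union>y\<in>E `` {r}. {\<omega> \<in> space P. reach (link E \<omega>) n r y})"
      unfolding reach_event_def by blast
  qed (use finite_nbrs[OF r] event_reach in auto)
  also have "\<dots> \<le> (\<Sum>y\<in>E `` {r}. prob {\<omega> \<in> space P. reach (link E \<omega>) n r y})"
    using finite_nbrs[OF r] event_reach by (intro finite_measure_subadditive_finite) auto
  also have "\<dots> = (\<Sum>y\<in>E `` {r}. fst (surv n))"
    using surv_eq[of r _ n] by (intro sum.cong) (auto simp: reach_prob_def)
  also have "\<dots> = d * fst (surv n)" using regular[OF r] by simp
  finally show ?thesis .
qed

text \<open>The survival pairs decrease, and by continuity of \<open>F\<close> their limit is a
  fixed point in the unit square. If its first component vanishes, \<open>theta_le\<close> forces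
  the claim.\<close>

lemma theta_eq_0:
  assumes r: "r \<in> V"
    and fixed: "\<And>a b. 0 \<le> a \<Longrightarrow> a \<le> 1 \<Longrightarrow> 0 \<le> b \<Longrightarrow> b \<le> 1 \<Longrightarrow>
      a = step_reach a b \<Longrightarrow> b = step_back a b \<Longrightarrow> a = 0"
  shows "theta d V E r p = 0"
\<comment> \<open>For \<open>d = 0\<close> there is no edge to which \<open>surv_bounds\<close>
  could be applied, but the bound in \<open>theta_le\<close> is then 0.\<close>
proof (cases "d = 0")
  case True
  have "0 \<le> theta d V E r p" by (simp add: theta_def)
  then show ?thesis using theta_le[OF r, of 0] True by simp
next
  case False
  then have "E `` {r} \<noteq> {}" using regular[OF r] by auto
  then obtain y where e: "(r, y) \<in> E" by auto
  note sb = surv_bounds[OF e]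
  have le1: "snd (surv n) \<le> 1" "0 \<le> fst (surv n)" for n
    using sb[of n] by linarith+
  have "decseq (\<lambda>n. fst (surv n))" "decseq (\<lambda>n. snd (surv n))"
    using sb by (auto simp: decseq_Suc_iff simp del: surv.simps)
  then obtain a b where a: "(\<lambda>n. fst (surv n)) \<longlonglongrightarrow> a" and b: "(\<lambda>n. snd (surv n)) \<longlonglongrightarrow> b"
    using decseq_convergent[of "\<lambda>n. fst (surv n)" 0] decseq_convergent[of "\<lambda>n. snd (surv n)" 0]
      sb le1 by metis
  have "(\<lambda>n. fst (surv (Suc n))) \<longlonglongrightarrow> step_reach a b" "(\<lambda>n. snd (surv (Suc n))) \<longlonglongrightarrow> step_back a b"
    unfolding surv.simps fst_conv snd_conv step_reach_def step_back_def
    by (intro tendsto_intros a b)+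
  then have "a = step_reach a b" "b = step_back a b"
    using LIMSEQ_unique LIMSEQ_Suc[OF a] LIMSEQ_Suc[OF b] by blast+
  moreover have "0 \<le> a" "a \<le> 1" "0 \<le> b" "b \<le> 1"
    using a b sb le1 by (auto intro: LIMSEQ_le_const LIMSEQ_le_const2)
  ultimately have "a = 0" using fixed by blast
  then have "(\<lambda>n. d * fst (surv n)) \<longlonglongrightarrow> real d * 0"
    using a by (intro tendsto_intros) auto
  then have "theta d V E r p \<le> real d * 0"
    using theta_le[OF r] by (intro LIMSEQ_le_const) auto
  moreover have "0 \<le> theta d V E r p" by (simp add: theta_def)
  ultimately show ?thesis by simp
qed

text \<open>By monotonicity of \<open>F\<close>, a subsolution below the initial pair stays below
  all survival pairs. A single neighbour that selects the root and survives then gives the uniform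
  lower bound \<open>b\<close>.\<close>

lemma theta_pos:
  assumes r: "r \<in> V" and d: "0 < d"
    and ab: "0 \<le> a" "a \<le> 1" "0 < b" "b \<le> snd (surv 0)"
    and sub: "a \<le> step_reach a b" "b \<le> step_back a b"
  shows "0 < theta d V E r p"
proof -
  have "E `` {r} \<noteq> {}" using regular[OF r] d by auto
  then obtain y where e: "(r, y) \<in> E" by auto
  note sb = surv_bounds[OF e]
  have le: "a \<le> fst (surv n) \<and> b \<le> snd (surv n)" for n
  proof (induction n)
    case 0
    then show ?case using ab by simp
  next
    case (Suc n)
    have "snd (surv n) \<le> 1" using sb[of n] by linarith
    then have "step_reach a b \<le> fst (surv (Suc n))" "step_back a b \<le> snd (surv (Suc n))"
      unfolding surv.simps fst_conv snd_conv using Suc sb ab d by (auto intro!: step_mono)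
    then show ?case using sub by linarith
  qed
  have "b \<le> theta d V E r p"
  proof (rule LIMSEQ_le_const[OF theta_limit[OF r]], intro exI[of _ 0] allI impI)
    fix n
    have "b \<le> back_prob n r y"
      using le[of n] surv_eq[OF e, of n] by simp
    also have "\<dots> \<le> prob (reach_event r n)"
      unfolding back_prob_def
    proof (rule finite_measure_mono[OF _ event_reach_event[OF r]])
      show "{\<omega> \<in> space P. r \<in> \<omega> y \<and> reach (link E \<omega>) n r y} \<subseteq> reach_event r n"
        using e unfolding reach_event_def by blast
    qed
    finally show "b \<le> prob (reach_event r n)" .
  qed
  then show ?thesis using ab by simp
qed

section \<open>Explicit equations and the three parameter regimes\<close>

lemma step_at_most_two:
  assumes d: "3 \<le> d" and p0: "\<forall>k\<in>{3..d}. p k = 0" and D: "d = D + 1"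
  shows "d * step_reach a b = (d * p 0 + p 1) * (1 - (1 - b) ^ D) +
      (D * p 1 + 2 * p 2) * (1 - (1 - a) * (1 - b) ^ (D - 1)) +
      (real D - 1) * p 2 * (1 - (1 - a)\<^sup>2 * (1 - b) ^ (D - 2))" (is ?th1)
    and "d * step_back a b = p 1 * (1 - (1 - b) ^ D) + 2 * p 2 * (1 - (1 - a) * (1 - b) ^ (D - 1))" (is ?th2)
    and "d * snd (surv 0) = p 1 + 2 * p 2" (is ?th3)
proof -
  have "2 \<le> D" using d D by simp
  have w0: "w k = 0" if "3 \<le> k" "k \<le> d" for k using p0 that by (simp add: w_def)
  have ch: "real (D choose 2) = D * (real D - 1) / 2" "real (d choose 2) = d * D / 2"
  proof -
    have *: "2 * real (Suc n choose 2) = real (Suc n) * real n" for n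
      by (simp only: choose_two diff_Suc_1, subst real_of_nat_div) (auto simp: algebra_simps)
    show "real (D choose 2) = D * (real D - 1) / 2" "real (d choose 2) = d * D / 2"
      using *[of "D - 1"] *[of D] D d by (auto simp: algebra_simps)
  qed
  have pos: "0 < real d" "0 < real D" using d D by auto
  \<comment> \<open>Multiplying by \<open>d\<close> clears the denominators of the weights. The
    value \<open>w 3\<close> occurs because the term for \<open>k = 2\<close> pairs
    \<open>w 2\<close> with \<open>w 3\<close>.\<close>
  have w: "w 0 = p 0" "d * w 1 = p 1" "d * D * w 2 = 2 * p 2" "w 3 = 0"
    using pos w0[OF order_refl d] by (simp_all add: w_def ch)
  have d1: "d - 1 = D" using D by simp
  have w00: "w k = 0" "w (Suc k) = 0" if "3 \<le> k" "k \<le> D" for k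
    using w0 that D by simp_all
  have sum3: "(\<Sum>k\<le>D. f k) = f 0 + f 1 + f 2"
    if "\<And>k. 3 \<le> k \<Longrightarrow> k \<le> D \<Longrightarrow> f k = 0" for f :: "nat \<Rightarrow> real"
  proof -
    have "(\<Sum>k\<le>D. f k) = (\<Sum>k\<in>{0, 1, 2}. f k)"
    proof (rule sum.mono_neutral_right)
      show "\<forall>i\<in>{..D} - {0, 1, 2}. f i = 0"
      proof
        fix i assume "i \<in> {..D} - {0, 1, 2}"
        then have "3 \<le> i" "i \<le> D" by auto
        then show "f i = 0" by (rule that)
      qed
    qed (use d D in auto)
    then show ?thesis by simp
  qed
  have e1: "step_reach a b = (w 0 + w 1) * (1 - (1 - b) ^ D) +
      D * (w 1 + w 2) * (1 - (1 - a) * (1 - b) ^ (D - 1)) +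
      (D choose 2) * w 2 * (1 - (1 - a)\<^sup>2 * (1 - b) ^ (D - 2))"
    unfolding step_reach_def d1 using w(4) w00
    by (subst sum3) (simp_all add: choose_one One_nat_def[symmetric] del: One_nat_def)
  have e2: "step_back a b = w 1 * (1 - (1 - b) ^ D) + D * w 2 * (1 - (1 - a) * (1 - b) ^ (D - 1))"
    unfolding step_back_def d1 using w(4) w00
    by (subst sum3) (simp_all add: choose_one One_nat_def[symmetric] del: One_nat_def)
  have e3: "snd (surv 0) = w 1 + D * w 2"
    unfolding surv.simps snd_conv d1 using w(4) w00
    by (subst sum3) (simp_all add: choose_one One_nat_def[symmetric] del: One_nat_def)
  have "d * step_reach a b = (d * w 0 + d * w 1) * (1 - (1 - b) ^ D) +
      (D * (d * w 1) + d * D * w 2) * (1 - (1 - a) * (1 - b) ^ (D - 1)) +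
      (real D - 1) * (d * D * w 2) / 2 * (1 - (1 - a)\<^sup>2 * (1 - b) ^ (D - 2))"
    unfolding e1 ch by (simp add: algebra_simps)
  then show ?th1 by (simp only: w) simp
  have "d * step_back a b = d * w 1 * (1 - (1 - b) ^ D) + d * D * w 2 * (1 - (1 - a) * (1 - b) ^ (D - 1))"
    unfolding e2 by (simp add: algebra_simps)
  then show ?th2 by (simp only: w)
  have "d * snd (surv 0) = d * w 1 + d * D * w 2"
    unfolding e3 by (simp add: algebra_simps)
  then show ?th3 by (simp only: w)
qed

text \<open>Above the critical value a subsolution exists below the initial pair; otherwise 0 is the
  only possible first component of a fixed point.\<close>

lemma theta_one_two:
  assumes d: "3 \<le> d" and r: "r \<in> V" and p0: "\<And>i. i \<le> d \<Longrightarrow> i \<noteq> 1 \<Longrightarrow> i \<noteq> 2 \<Longrightarrow> p i = 0"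
    and p12: "p 1 = 1 - q" "p 2 = q"
  shows "0 < theta d V E r p \<longleftrightarrow> pc2 d < q"
proof -
  define D where "D = d - 1"
  have D: "d = D + 1" "2 \<le> D" using d by (auto simp: D_def)
  have q: "0 \<le> q" "q \<le> 1"
    using p p12 d unfolding prob_vector_def by (force, smt (verit) le_trans one_le_numeral)
  have "p 0 = 0" using p0 by simp
  have p3: "\<forall>k\<in>{3..d}. p k = 0" using p0 by simp
  note step = step_at_most_two[OF d p3 D(1), unfolded p12 \<open>p 0 = 0\<close>]
  have reach: "d * step_reach a b = (1 - q) * (1 - (1 - b) ^ D) +
      (D * (1 - q) + 2 * q) * (1 - (1 - a) * (1 - b) ^ (D - 1)) +
      (real D - 1) * q * (1 - (1 - a)\<^sup>2 * (1 - b) ^ (D - 2))" for a b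
    using step(1)[of a b] by simp
  note iff = pc2_less_iff[OF d q D(1)]
  show ?thesis
  proof (cases "pc2 d < q")
    case True
    have "0 < snd (surv 0)"
    proof -
      have "d * snd (surv 0) = 1 + q" using step(3) by (simp del: surv.simps)
      then have "0 < d * snd (surv 0)" using q by linarith
      then show ?thesis using d by (simp add: zero_less_mult_iff del: surv.simps)
    qed
    moreover have "0 < q" using True pc2_bounds(1)[OF d] by linarith
    ultimately obtain a b :: real where ab: "0 < a" "a \<le> 1" "0 < b" "b \<le> 1" "b \<le> snd (surv 0)"
      "(D + 1) * a \<le> d * step_reach a b" "(D + 1) * b \<le> d * step_back a b"
      using supercritical_subsolution[OF D(2) _ q(2) _ iff[THEN iffD1, OF True]]
      unfolding reach step(2) by metis
    have "a \<le> step_reach a b" "b \<le> step_back a b"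
      using ab(6,7) d unfolding D(1)[symmetric] by (simp_all add: D(1)[symmetric])
    then have "0 < theta d V E r p"
      using ab d by (intro theta_pos[OF r]) auto
    then show ?thesis using True by simp
  next
    case False
    have "q * D < 1"
    proof -
      have "q * D \<le> pc2 d * D" using False by (intro mult_right_mono) auto
      then show ?thesis using pc2_bounds(2)[OF d] D(1) by simp
    qed
    have "theta d V E r p = 0"
    proof (rule theta_eq_0[OF r])
      fix a b assume ab: "0 \<le> a" "a \<le> 1" "0 \<le> b" "b \<le> 1" "a = step_reach a b" "b = step_back a b"
      show "a = 0"
      proof (rule critical_fixed_point[OF D(2) q(1) _ \<open>q * D < 1\<close> _ ab(1-4)])
        show "q < 1" using False pc2_bounds(3)[OF d] by simp
        show "0 \<le> (1 - q * D) * (1 - q * (real D - 2)) - 2 * q * D * (D - q)"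
          using iff False by simp
        show "(D + 1) * a = (1 - q) * (1 - (1 - b) ^ D) +
            (D * (1 - q) + 2 * q) * (1 - (1 - a) * (1 - b) ^ (D - 1)) +
            (real D - 1) * q * (1 - (1 - a)\<^sup>2 * (1 - b) ^ (D - 2))"
          using reach[of a b] unfolding ab(5)[symmetric] D(1)[symmetric] .
        show "(D + 1) * b = (1 - q) * (1 - (1 - b) ^ D) + 2 * q * (1 - (1 - a) * (1 - b) ^ (D - 1))"
          using step(2)[of a b] unfolding ab(6)[symmetric] D(1)[symmetric] .
      qed
    qed
    then show ?thesis using False by simp
  qed
qed

text \<open>With \<open>p 2 = 0\<close> the equation for \<open>b\<close> no longer involves
  \<open>a\<close>. It gives \<open>d * b \<le> D * b\<close>, so \<open>b = 0\<close>, and then the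
  other one gives \<open>d * a \<le> D * a\<close>.\<close>

lemma theta_at_most_one:
  assumes d: "3 \<le> d" and r: "r \<in> V" and p01: "p 0 + p 1 = 1"
  shows "theta d V E r p = 0"
proof -
  define D where "D = d - 1"
  have D: "d = D + 1" "2 \<le> D" using d by (auto simp: D_def)
  have nn: "\<And>i. i \<le> d \<Longrightarrow> 0 \<le> p i" and sum1: "(\<Sum>i\<le>d. p i) = 1"
    using p by (auto simp: prob_vector_def)
  have "(\<Sum>i\<le>d. p i) = (\<Sum>i\<in>{..d} - {0, 1}. p i) + (\<Sum>i\<in>{0, 1}. p i)"
    using d by (intro sum.subset_diff) auto
  then have "(\<Sum>i\<in>{..d} - {0, 1}. p i) = 0" using sum1 p01 by simp
  then have p0: "p i = 0" if "2 \<le> i" "i \<le> d" for i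
    using nn that by (subst (asm) sum_nonneg_eq_0_iff) auto
  then have "p 2 = 0" using d by simp
  have p1: "0 \<le> p 1" "p 1 \<le> 1" using nn[of 0] nn[of 1] p01 d by auto
  have p3: "\<forall>k\<in>{3..d}. p k = 0" using p0 by simp
  note step = step_at_most_two[OF d p3 D(1), unfolded \<open>p 2 = 0\<close>]
  show ?thesis
  proof (rule theta_eq_0[OF r])
    fix a b assume ab: "0 \<le> a" "a \<le> 1" "0 \<le> b" "b \<le> 1" "a = step_reach a b" "b = step_back a b"
    have "d * b = p 1 * (1 - (1 - b) ^ D)"
      using step(2)[of a b] ab(6) by simp
    also have "\<dots> \<le> 1 * (D * b)"
      using one_minus_prod_powers_le[OF ab(1-4), of 0 D] p1 ab
      by (intro mult_mono) (auto intro: power_le_one)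
    finally have "b = 0" using ab D by (simp add: algebra_simps)
    then have "d * a = D * p 1 * a"
      using step(1)[of a b] ab(5) by simp
    also have "\<dots> \<le> real D * 1 * a"
      using p1 ab by (intro mult_left_mono mult_right_mono) auto
    finally show "a = 0" using ab D by (simp add: algebra_simps)
  qed
qed

text \<open>Every state of positive weight contains a child, so a vertex linked to its parent
  survives with certainty. Accordingly the initial pair \<open>(1, b)\<close> is an exact fixed
  point of \<open>F\<close>: terms with \<open>k = 0\<close> have weight 0, and for
  \<open>k > 0\<close> the factor \<open>(1 - 1) ^ k\<close> vanishes.\<close>

lemma theta_at_least_two:
  assumes d: "3 \<le> d" and r: "r \<in> V" and p2: "(\<Sum>i=2..d. p i) = 1"
  shows "0 < theta d V E r p"
proof -
  have "E `` {r} \<noteq> {}" using regular[OF r] d by auto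
  then obtain y where e: "(r, y) \<in> E" by auto
  have nn: "\<And>i. i \<le> d \<Longrightarrow> 0 \<le> p i" and sum1: "(\<Sum>i\<le>d. p i) = 1"
    using p by (auto simp: prob_vector_def)
  have "{..d} - {2..d} = {0, 1}" using d by auto
  moreover have "(\<Sum>i\<le>d. p i) = (\<Sum>i\<in>{..d} - {2..d}. p i) + (\<Sum>i=2..d. p i)"
    by (intro sum.subset_diff) auto
  ultimately have "p 0 + p 1 = 0" using sum1 p2 by simp
  then have "p 0 = 0" "p 1 = 0" using nn[of 0] nn[of 1] d by auto
  then have w0: "w 0 = 0" "w (Suc 0) = 0" by (auto simp: w_def)
  have "\<exists>i\<in>{2..d}. 0 < p i"
  proof (rule ccontr)
    assume "\<not> ?thesis"
    then have "(\<Sum>i=2..d. p i) \<le> 0" by (intro sum_nonpos) (auto simp: not_less)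
    then show False using p2 by simp
  qed
  then obtain i where i: "2 \<le> i" "i \<le> d" "0 < p i" by auto
  define b where "b = (\<Sum>k\<le>d - 1. real (d - 1 choose k) * w (Suc k))"
  have "0 < b"
    unfolding b_def
  \<comment> \<open>A state of size \<open>i\<close> that contains the parent has
    \<open>i - 1\<close> children.\<close>
  proof (rule sum_pos2[of _ "i - 1"])
    show "0 < real (d - 1 choose (i - 1)) * w (Suc (i - 1))"
      using i by (auto simp: w_def)
  qed (use i w_nonneg in auto)
  moreover have "step_reach 1 b = 1"
    unfolding step_reach_def
    by (subst sum_weights[OF e, symmetric], rule sum.cong[OF refl]) (auto simp: w0 power_0_left)
  moreover have "step_back 1 b = b"
    unfolding step_back_def
    by (subst b_def, rule sum.cong[OF refl]) (auto simp: w0 power_0_left)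
  ultimately show ?thesis
    using d by (intro theta_pos[OF r, of 1 b]) (auto simp: b_def)
qed

end

theorem theorem2:
  shows
    "(\<forall>d\<ge>3. \<forall>(V :: 'v set) E r. regular_tree d V E \<and> r \<in> V \<longrightarrow>
        (\<forall>(p :: real) (pv :: nat \<Rightarrow> real). 0 \<le> p \<and> p \<le> 1 \<and> pv 1 = 1 - p \<and> pv 2 = p \<and> (\<forall>i\<le>d. i \<noteq> 1 \<and> i \<noteq> 2 \<longrightarrow> pv i = 0) \<longrightarrow>
           (0 < theta d V E r pv \<longleftrightarrow> pc2 d < p)) \<and>
        (\<forall>pv. prob_vector d pv \<longrightarrow>
           (pv 0 + pv 1 = 1 \<longrightarrow> theta d V E r pv = 0) \<and>
           ((\<Sum>i=2..d. pv i) = 1 \<longrightarrow> 0 < theta d V E r pv))) \<and>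
     strict_antimono_on {3..} pc2 \<and>
     (\<forall>d\<ge>3. 0 < pc2 d \<and> pc2 d < 1) \<and>
     pc2 \<sim>[at_top] (\<lambda>d. 1 / (2 * (real d)\<^sup>2))"
proof (intro conjI allI impI)
  fix d :: nat and V :: "'v set" and E r and p :: real and pv :: "nat \<Rightarrow> real"
  assume d: "3 \<le> d" and tree: "regular_tree d V E \<and> r \<in> V"
    and pv: "0 \<le> p \<and> p \<le> 1 \<and> pv 1 = 1 - p \<and> pv 2 = p \<and> (\<forall>i\<le>d. i \<noteq> 1 \<and> i \<noteq> 2 \<longrightarrow> pv i = 0)"
  have "(\<Sum>i\<le>d. pv i) = (\<Sum>i\<in>{1, 2}. pv i)"
    by (rule sum.mono_neutral_right) (use d pv in auto)
  moreover have "0 \<le> pv i" if "i \<le> d" for i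
    using pv that by (cases "i = 1 \<or> i = 2") auto
  ultimately have "prob_vector d pv"
    using pv by (simp add: prob_vector_def)
  then interpret percolation d V E pv
    using tree by (simp add: percolation_def percolation_axioms_def)
  show "0 < theta d V E r pv \<longleftrightarrow> pc2 d < p"
    using theta_one_two[OF d] tree pv by blast
next
  fix d :: nat and V :: "'v set" and E r and pv :: "nat \<Rightarrow> real"
  assume d: "3 \<le> d" and tree: "regular_tree d V E \<and> r \<in> V" and pv: "prob_vector d pv"
  interpret percolation d V E pv
    using tree pv by (simp add: percolation_def percolation_axioms_def)
  show "theta d V E r pv = 0" if "pv 0 + pv 1 = 1"
    using theta_at_most_one[OF d] tree that by blast
  show "0 < theta d V E r pv" if "(\<Sum>i=2..d. pv i) = 1"
    using theta_at_least_two[OF d] tree that by blast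
qed (use pc2_strict_antimono pc2_bounds pc2_asymp in auto)

end
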